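(* Let $f\in\mathbb{Z}[X]$ be a polynomial in one variable with integral coefficients. The following conditions are equivalent. (1) $f$ defines generic units. (2) $f$ defines units on infinitely many orders, i.e. there are infinitely many positive integers $n$ such that $f$ defines a unit on order $n$.
   Context: For a group $G$, $\mathbb{Z}G$ denotes the integral group ring. For $x\in G$ and $f\in\mathbb{Z}[X]$, $f(x)\in\mathbb{Z}G$ is the element obtained by evaluating $f$ at $x$. If $x\in G$ has finite order $n$, whether $f(x)$ is a unit of $\mathbb{Z}G$ depends only on $n$ (and $f$); when it is a unit, $f$ is said to define a unit on order $n$ (equivalently, the class of $f$ is a unit in $\mathbb{Z}[X]/(X^n-1)$). The polynomial $f$ defines generic units if there is a positive integer $D$ such that $f$ defines a unit on every order $n$ (positive integer) coprime with $D$. *)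

theory Defs
  imports "HOL-Algebra.Algebra" "HOL-Library.Poly_Mapping"
    "HOL-Computational_Algebra.Polynomial"
begin

text \<open>
  The integral group ring of \<open>G\<close>: finitely supported functions \<open>carrier G \<rightarrow> \<int>\<close>, where
  \<open>frag_of g\<close> is the basis element given by \<open>g\<close>. The product is the \<open>\<int>\<close>-bilinear extension
  of the product of \<open>G\<close>.
\<close>

definition group_ring :: "('a, 'm) monoid_scheme \<Rightarrow> ('a \<Rightarrow>\<^sub>0 int) ring" where
  "group_ring G =
    \<lparr>carrier = {a. Poly_Mapping.keys a \<subseteq> carrier G},
     monoid.mult = (\<lambda>a b. frag_extend (\<lambda>g. frag_extend (\<lambda>h. frag_of (g \<otimes>\<^bsub>G\<^esub> h)) b) a),
     monoid.one = frag_of \<one>\<^bsub>G\<^esub>,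
     ring.zero = 0,
     ring.add = (+)\<rparr>"

definition int_poly_eval :: "('r, 'm) ring_scheme \<Rightarrow> int poly \<Rightarrow> 'r \<Rightarrow> 'r" where
  "int_poly_eval R f a =
    (\<Oplus>\<^bsub>R\<^esub>i\<in>{..Polynomial.degree f}. [Polynomial.coeff f i] \<cdot>\<^bsub>R\<^esub> (a [^]\<^bsub>R\<^esub> i))"

text \<open>
  Types cannot be quantified inside a formula, so \<open>G\<close> ranges over groups on subsets of \<^typ>\<open>int\<close>
  here; every finite order occurs among these. Lemma \<open>defines_unit_on_order_iff\<close> below shows that
  for \<open>n > 0\<close> any element of order \<open>n\<close> of any group on any type decides the property.
  For \<open>n = 0\<close> (infinite order in \<^const>\<open>group.ord\<close>) the predicate is not meant to be used.
\<close>

definition defines_unit_on_order :: "int poly \<Rightarrow> nat \<Rightarrow> bool" where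
  "defines_unit_on_order f n \<longleftrightarrow>
    (\<forall>(G :: int monoid) x. group G \<and> x \<in> carrier G \<and> group.ord G x = n \<longrightarrow>
      int_poly_eval (group_ring G) f (frag_of x) \<in> Units (group_ring G))"

definition defines_generic_units :: "int poly \<Rightarrow> bool" where
  "defines_generic_units f \<longleftrightarrow>
    (\<exists>D::nat. D > 0 \<and> (\<forall>n::nat. n > 0 \<and> coprime n D \<longrightarrow> defines_unit_on_order f n))"


lemma group_ring_simps:
  "carrier (group_ring G) = {a. Poly_Mapping.keys a \<subseteq> carrier G}"
  "a \<otimes>\<^bsub>group_ring G\<^esub> b = frag_extend (\<lambda>g. frag_extend (\<lambda>h. frag_of (g \<otimes>\<^bsub>G\<^esub> h)) b) a"
  "\<one>\<^bsub>group_ring G\<^esub> = frag_of \<one>\<^bsub>G\<^esub>"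
  "\<zero>\<^bsub>group_ring G\<^esub> = 0"
  "a \<oplus>\<^bsub>group_ring G\<^esub> b = a + b"
  by (simp_all add: group_ring_def)

lemma frag_extend_fun_diff:
  "frag_extend (\<lambda>g. F g - H g) a = frag_extend F a - frag_extend H a"
  by (simp add: frag_extend_def sum_subtractf[symmetric])
     (intro sum.cong refl poly_mapping_eqI, simp add: lookup_minus algebra_simps)

lemma group_ring_mult_diff:
  "(a - b) \<otimes>\<^bsub>group_ring G\<^esub> c = a \<otimes>\<^bsub>group_ring G\<^esub> c - b \<otimes>\<^bsub>group_ring G\<^esub> c"
  "c \<otimes>\<^bsub>group_ring G\<^esub> (a - b) = c \<otimes>\<^bsub>group_ring G\<^esub> a - c \<otimes>\<^bsub>group_ring G\<^esub> b"
  by (simp_all add: group_ring_simps frag_extend_diff frag_extend_fun_diff)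

lemma group_ring_mult_0:
  "0 \<otimes>\<^bsub>group_ring G\<^esub> c = 0" "c \<otimes>\<^bsub>group_ring G\<^esub> 0 = 0"
  by (simp_all add: group_ring_simps frag_extend_eq_0)

lemma group_ring_mult_add:
  "(a + b) \<otimes>\<^bsub>group_ring G\<^esub> c = a \<otimes>\<^bsub>group_ring G\<^esub> c + b \<otimes>\<^bsub>group_ring G\<^esub> c"
  "c \<otimes>\<^bsub>group_ring G\<^esub> (a + b) = c \<otimes>\<^bsub>group_ring G\<^esub> a + c \<otimes>\<^bsub>group_ring G\<^esub> b"
  using group_ring_mult_diff(1)[of G a "0 - b" c] group_ring_mult_diff(1)[of G 0 b c]
    group_ring_mult_diff(2)[of G c a "0 - b"] group_ring_mult_diff(2)[of G c 0 b]
  by (simp_all add: group_ring_mult_0)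

lemma group_ring_mult_of:
  "frag_of g \<otimes>\<^bsub>group_ring G\<^esub> frag_of h = frag_of (g \<otimes>\<^bsub>G\<^esub> h)"
  by (simp add: group_ring_simps)

lemma group_ring_cmul_mult:
  "frag_cmul k a \<otimes>\<^bsub>group_ring G\<^esub> b = frag_cmul k (a \<otimes>\<^bsub>group_ring G\<^esub> b)"
  by (simp add: group_ring_simps frag_extend_cmul)

context group
begin

lemma group_ring_mult_closed:
  assumes "a \<in> carrier (group_ring G)" "b \<in> carrier (group_ring G)"
  shows "a \<otimes>\<^bsub>group_ring G\<^esub> b \<in> carrier (group_ring G)"
proof -
  have "Poly_Mapping.keys (frag_extend (\<lambda>h. frag_of (g \<otimes> h)) b) \<subseteq> carrier G"
    if "g \<in> Poly_Mapping.keys a" for g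
  proof -
    have "Poly_Mapping.keys (frag_of (g \<otimes> h)) \<subseteq> carrier G" if "h \<in> Poly_Mapping.keys b" for h
      using that \<open>g \<in> Poly_Mapping.keys a\<close> assms by (auto simp: group_ring_simps)
    with keys_frag_extend show ?thesis by fastforce
  qed
  with keys_frag_extend show ?thesis
    unfolding group_ring_simps by fastforce
qed

lemma group_ring_mult_assoc:
  assumes "a \<in> carrier (group_ring G)" "b \<in> carrier (group_ring G)" "c \<in> carrier (group_ring G)"
  shows "(a \<otimes>\<^bsub>group_ring G\<^esub> b) \<otimes>\<^bsub>group_ring G\<^esub> c = a \<otimes>\<^bsub>group_ring G\<^esub> (b \<otimes>\<^bsub>group_ring G\<^esub> c)"
proof -
  have K: "Poly_Mapping.keys a \<subseteq> carrier G" "Poly_Mapping.keys b \<subseteq> carrier G"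
    "Poly_Mapping.keys c \<subseteq> carrier G"
    using assms by (auto simp: group_ring_simps)
  show ?thesis
    using K(1)
  proof (induction a rule: frag_induction)
    case (one x)
    show ?case
      using K(2)
    proof (induction b rule: frag_induction)
      case (one y)
      show ?case
        using K(3)
        by (induction c rule: frag_induction)
           (simp_all add: group_ring_mult_diff group_ring_mult_0 group_ring_mult_of
             m_assoc \<open>x \<in> carrier G\<close> \<open>y \<in> carrier G\<close>)
    qed (simp_all add: group_ring_mult_diff group_ring_mult_0)
  qed (simp_all add: group_ring_mult_diff group_ring_mult_0)
qed

lemma group_ring_mult_one:
  assumes "a \<in> carrier (group_ring G)"
  shows "\<one>\<^bsub>group_ring G\<^esub> \<otimes>\<^bsub>group_ring G\<^esub> a = a" "a \<otimes>\<^bsub>group_ring G\<^esub> \<one>\<^bsub>group_ring G\<^esub> = a"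
proof -
  have "Poly_Mapping.keys a \<subseteq> carrier G"
    using assms by (auto simp: group_ring_simps)
  then have "frag_of \<one> \<otimes>\<^bsub>group_ring G\<^esub> a = a \<and> a \<otimes>\<^bsub>group_ring G\<^esub> frag_of \<one> = a"
    by (induction a rule: frag_induction)
       (simp_all add: group_ring_mult_diff group_ring_mult_0 group_ring_mult_of)
  then show "\<one>\<^bsub>group_ring G\<^esub> \<otimes>\<^bsub>group_ring G\<^esub> a = a" "a \<otimes>\<^bsub>group_ring G\<^esub> \<one>\<^bsub>group_ring G\<^esub> = a"
    by (simp_all add: group_ring_simps(3))
qed

lemma ring_group_ring: "ring (group_ring G)"
proof (rule ringI)
  show "abelian_group (group_ring G)"
  proof (rule abelian_groupI)
    fix a assume "a \<in> carrier (group_ring G)"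
    then show "\<exists>b\<in>carrier (group_ring G). b \<oplus>\<^bsub>group_ring G\<^esub> a = \<zero>\<^bsub>group_ring G\<^esub>"
      by (intro bexI[of _ "- a"]) (auto simp: group_ring_simps)
  qed (use keys_add in \<open>fastforce simp: group_ring_simps add_ac\<close>)+
  show "monoid (group_ring G)"
    by (rule monoidI)
       (auto simp: group_ring_mult_closed group_ring_mult_assoc group_ring_mult_one,
        simp add: group_ring_simps)
qed (simp_all add: group_ring_simps(5) group_ring_mult_add)

lemma group_ring_add_pow:
  assumes "a \<in> carrier (group_ring G)"
  shows "[(k::int)] \<cdot>\<^bsub>group_ring G\<^esub> a = frag_cmul k a"
proof -
  interpret R: ring "group_ring G" by (rule ring_group_ring)
  have nat: "[(m::nat)] \<cdot>\<^bsub>group_ring G\<^esub> a = frag_cmul (int m) a" for m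
    using assms
    by (induction m)
       (simp_all add: add_pow_def group_ring_simps frag_cmul_distrib algebra_simps)
  show ?thesis
  proof (cases "k \<ge> 0")
    case True
    then show ?thesis by (simp add: add_pow_int_ge nat)
  next
    case False
    have c: "frag_cmul (- k) a \<in> carrier (group_ring G)"
      using assms by (auto simp: group_ring_simps)
    have "\<ominus>\<^bsub>group_ring G\<^esub> (frag_cmul (- k) a) = frag_cmul k a"
      by (rule R.minus_equality)
         (use assms in \<open>auto simp: group_ring_simps frag_cmul_distrib[symmetric]\<close>)
    then show ?thesis
      using False by (simp add: add_pow_int_lt nat)
  qed
qed

lemma group_ring_eval_eq:
  assumes x: "x \<in> carrier G"
  shows "int_poly_eval (group_ring G) f (frag_of x) =
    (\<Sum>i\<le>Polynomial.degree f. frag_cmul (Polynomial.coeff f i) (frag_of (x [^] i)))"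
proof -
  interpret R: ring "group_ring G" by (rule ring_group_ring)
  have p: "frag_of x [^]\<^bsub>group_ring G\<^esub> (i::nat) = frag_of (x [^] i)" for i
    by (induction i) (simp_all add: group_ring_mult_of, simp add: group_ring_simps)
  have c: "frag_of (x [^] (i::nat)) \<in> carrier (group_ring G)" for i
    using x by (simp add: group_ring_simps)
  have s: "(\<Oplus>\<^bsub>group_ring G\<^esub>i\<in>I. F i) = sum F I"
    if "finite I" "F \<in> I \<rightarrow> carrier (group_ring G)" for F :: "nat \<Rightarrow> _" and I
    using that by (induction I rule: finite_induct) (simp_all add: group_ring_simps(4,5))
  have "frag_cmul k (frag_of (x [^] (i::nat))) \<in> carrier (group_ring G)" for k i
    using x by (auto simp: group_ring_simps)
  then show ?thesis
    unfolding int_poly_eval_def p by (simp add: group_ring_add_pow c s)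
qed

lemma group_ring_eval_closed:
  "x \<in> carrier G \<Longrightarrow> int_poly_eval (group_ring G) f (frag_of x) \<in> carrier (group_ring G)"
  unfolding group_ring_eval_eq group_ring_simps
  using keys_sum by fastforce

lemma group_ring_eval_bound:
  assumes "x \<in> carrier G" "Polynomial.degree f \<le> N"
  shows "int_poly_eval (group_ring G) f (frag_of x) =
    (\<Sum>i\<le>N. frag_cmul (Polynomial.coeff f i) (frag_of (x [^] i)))"
  unfolding group_ring_eval_eq[OF assms(1)]
  by (rule sum.mono_neutral_left) (use assms in \<open>auto simp: coeff_eq_0\<close>)

lemma group_ring_eval_add:
  assumes "x \<in> carrier G"
  shows "int_poly_eval (group_ring G) (f + g) (frag_of x) =
    int_poly_eval (group_ring G) f (frag_of x) + int_poly_eval (group_ring G) g (frag_of x)"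
proof -
  let ?N = "max (Polynomial.degree f) (Polynomial.degree g)"
  show ?thesis
    using assms
    by (simp add: group_ring_eval_bound[of x _ ?N] degree_add_le frag_cmul_distrib sum.distrib)
qed

lemma group_ring_eval_diff:
  assumes "x \<in> carrier G"
  shows "int_poly_eval (group_ring G) (f - g) (frag_of x) =
    int_poly_eval (group_ring G) f (frag_of x) - int_poly_eval (group_ring G) g (frag_of x)"
  using group_ring_eval_add[OF assms, of "f - g" g] by simp

lemma group_ring_eval_smult:
  assumes "x \<in> carrier G"
  shows "int_poly_eval (group_ring G) (smult k f) (frag_of x) =
    frag_cmul k (int_poly_eval (group_ring G) f (frag_of x))"
  using assms
  by (simp add: group_ring_eval_bound[of x _ "Polynomial.degree f"] degree_smult_le frag_cmul_sum)

lemma group_ring_eval_monom: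
  assumes "x \<in> carrier G"
  shows "int_poly_eval (group_ring G) (Polynomial.monom k n) (frag_of x) =
    frag_cmul k (frag_of (x [^] n))"
proof -
  have "int_poly_eval (group_ring G) (Polynomial.monom k n) (frag_of x) =
      (\<Sum>i\<le>n. frag_cmul (if n = i then k else 0) (frag_of (x [^] i)))"
    using assms by (subst group_ring_eval_bound[of x _ n]) (simp_all add: degree_monom_le)
  also have "\<dots> = (\<Sum>i\<le>n. if n = i then frag_cmul k (frag_of (x [^] i)) else 0)"
    by (intro sum.cong) auto
  finally show ?thesis by simp
qed

lemma group_ring_eval_pCons:
  assumes x: "x \<in> carrier G"
  shows "int_poly_eval (group_ring G) (pCons 0 f) (frag_of x) =
    frag_of x \<otimes>\<^bsub>group_ring G\<^esub> int_poly_eval (group_ring G) f (frag_of x)"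
proof -
  interpret R: ring "group_ring G" by (rule ring_group_ring)
  have s: "frag_of x \<otimes>\<^bsub>group_ring G\<^esub> sum F I = (\<Sum>i\<in>I. frag_of x \<otimes>\<^bsub>group_ring G\<^esub> F i)"
    if "finite I" for F and I :: "nat set"
    using that by (induction I rule: finite_induct) (simp_all add: group_ring_mult_0 group_ring_mult_add)
  have t: "frag_of x \<otimes>\<^bsub>group_ring G\<^esub> frag_cmul k (frag_of (x [^] i)) =
      frag_cmul k (frag_of (x [^] Suc i))" for k and i :: nat
    unfolding group_ring_simps frag_extend_cmul frag_extend_of
    using x by (simp only: nat_pow_Suc2)
  have "int_poly_eval (group_ring G) (pCons 0 f) (frag_of x) =
      (\<Sum>i\<le>Suc (Polynomial.degree f). frag_cmul (Polynomial.coeff (pCons 0 f) i) (frag_of (x [^] i)))"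
    using x by (rule group_ring_eval_bound) (rule degree_pCons_le)
  also have "\<dots> = (\<Sum>i\<le>Polynomial.degree f. frag_cmul (Polynomial.coeff f i) (frag_of (x [^] Suc i)))"
    by (subst sum.atMost_Suc_shift) simp
  also have "\<dots> = frag_of x \<otimes>\<^bsub>group_ring G\<^esub> int_poly_eval (group_ring G) f (frag_of x)"
    unfolding group_ring_eval_eq[OF x] by (simp only: s t finite_atMost)
  finally show ?thesis .
qed

lemma group_ring_eval_mult:
  assumes x: "x \<in> carrier G"
  shows "int_poly_eval (group_ring G) (f * g) (frag_of x) =
    int_poly_eval (group_ring G) f (frag_of x) \<otimes>\<^bsub>group_ring G\<^esub> int_poly_eval (group_ring G) g (frag_of x)"
proof (induction f)
  case 0
  have "int_poly_eval (group_ring G) 0 (frag_of x) = 0"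
    by (simp add: group_ring_eval_eq x)
  then show ?case by (simp add: group_ring_mult_0)
next
  case (pCons a f)
  let ?e = "\<lambda>f. int_poly_eval (group_ring G) f (frag_of x)"
  have cx: "frag_of x \<in> carrier (group_ring G)"
    using x by (simp add: group_ring_simps)
  have "pCons a f = Polynomial.monom a 0 + pCons 0 f"
    by (simp add: monom_0)
  then have "?e (pCons a f) = frag_cmul a (frag_of \<one>) + frag_of x \<otimes>\<^bsub>group_ring G\<^esub> ?e f"
    by (simp add: group_ring_eval_add group_ring_eval_monom group_ring_eval_pCons x)
  then have "?e (pCons a f) \<otimes>\<^bsub>group_ring G\<^esub> ?e g =
      frag_cmul a (\<one>\<^bsub>group_ring G\<^esub> \<otimes>\<^bsub>group_ring G\<^esub> ?e g) +
      frag_of x \<otimes>\<^bsub>group_ring G\<^esub> (?e f \<otimes>\<^bsub>group_ring G\<^esub> ?e g)"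
    by (simp add: group_ring_mult_add group_ring_cmul_mult group_ring_mult_assoc
        group_ring_eval_closed x cx group_ring_simps(3))
  also have "\<dots> = ?e (pCons a f * g)"
    by (simp add: group_ring_mult_one group_ring_eval_closed x mult_pCons_left group_ring_eval_add
        group_ring_eval_smult group_ring_eval_pCons pCons.IH)
  finally show ?case by simp
qed

lemma group_ring_eval_one:
  "x \<in> carrier G \<Longrightarrow> int_poly_eval (group_ring G) 1 (frag_of x) = \<one>\<^bsub>group_ring G\<^esub>"
  using group_ring_eval_monom[of x 1 0] by (simp add: group_ring_simps(3))

lemma group_ring_eval_eq_0_iff:
  assumes x: "x \<in> carrier G" and n: "ord x = n" "n > 0"
  shows "int_poly_eval (group_ring G) p (frag_of x) = 0 \<longleftrightarrow> (Polynomial.monom 1 n - 1) dvd p"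
proof -
  let ?e = "\<lambda>f. int_poly_eval (group_ring G) f (frag_of x)"
  let ?m = "Polynomial.monom 1 n - 1 :: int poly"
  have m0: "?e ?m = 0"
    using pow_ord_eq_1[OF x] n
    by (simp add: group_ring_eval_diff group_ring_eval_monom group_ring_eval_one x group_ring_simps)
  have deg: "Polynomial.degree ?m = n"
    using n degree_add_eq_left[of "- 1" "Polynomial.monom (1::int) n"]
    by (simp add: Polynomial.degree_monom_eq)
  have lead: "Polynomial.coeff ?m n = 1"
    using n by simp
  have nz: "?m \<noteq> 0"
    using deg n by auto
  obtain q r where qr: "pseudo_divmod p ?m = (q, r)"
    by fastforce
  have pqr: "p = ?m * q + r"
    using pseudo_divmod(1)[OF nz qr] by (simp only: deg lead power_one smult_1_left)
  have rdeg: "r = 0 \<or> Polynomial.degree r < n"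
    using pseudo_divmod(2)[OF nz qr] deg by simp
  have pr: "?e p = ?e r"
    by (simp add: pqr group_ring_eval_add group_ring_eval_mult x m0 group_ring_mult_0)
  have "r = 0" if "?e r = 0"
  proof (rule ccontr)
    assume r: "r \<noteq> 0"
    let ?d = "Polynomial.degree r"
    have inj: "x [^] i = x [^] ?d \<longleftrightarrow> i = ?d" if "i \<le> ?d" for i
    proof -
      have "inj_on (\<lambda>a. x [^] a) {0..ord x - 1}"
        using x by (rule ord_inj)
      then show ?thesis
        using that rdeg r n by (auto simp: inj_on_def)
    qed
    have "Poly_Mapping.lookup (?e r) (x [^] ?d) =
        (\<Sum>i\<le>?d. if x [^] ?d = x [^] i then Polynomial.coeff r i else 0)"
      unfolding group_ring_eval_eq[OF x] lookup_sum
      by (intro sum.cong) auto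
    also have "\<dots> = (\<Sum>i\<le>?d. if i = ?d then Polynomial.coeff r i else 0)"
      by (intro sum.cong refl) (metis inj atMost_iff)
    also have "\<dots> = lead_coeff r"
      by simp
    finally show False
      using that r by simp
  qed
  moreover have "?m dvd p \<Longrightarrow> ?e p = 0"
    by (auto simp: group_ring_eval_mult x m0 group_ring_mult_0 elim!: dvdE)
  ultimately show ?thesis
    using pr pqr by auto
qed

lemma group_ring_eval_unit_iff:
  assumes x: "x \<in> carrier G" and n: "ord x = n" "n > 0"
  shows "int_poly_eval (group_ring G) f (frag_of x) \<in> Units (group_ring G) \<longleftrightarrow>
    (\<exists>g. (Polynomial.monom 1 n - 1) dvd (f * g - 1))"
proof
  let ?e = "\<lambda>f. int_poly_eval (group_ring G) f (frag_of x)"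
  assume "\<exists>g. (Polynomial.monom 1 n - 1) dvd (f * g - 1)"
  then obtain g where "(Polynomial.monom 1 n - 1) dvd (f * g - 1)" ..
  then have "?e (f * g - 1) = 0"
    using group_ring_eval_eq_0_iff[OF assms] by simp
  then have "?e (f * g) = \<one>\<^bsub>group_ring G\<^esub>"
    by (simp add: group_ring_eval_diff group_ring_eval_one x)
  then have "?e f \<otimes>\<^bsub>group_ring G\<^esub> ?e g = \<one>\<^bsub>group_ring G\<^esub>" "?e g \<otimes>\<^bsub>group_ring G\<^esub> ?e f = \<one>\<^bsub>group_ring G\<^esub>"
    using group_ring_eval_mult[OF x] by (simp_all add: mult.commute[of f g]) (metis mult.commute)
  then show "?e f \<in> Units (group_ring G)"
    using group_ring_eval_closed[OF x] by (auto simp: Units_def)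
next
  let ?e = "\<lambda>f. int_poly_eval (group_ring G) f (frag_of x)"
  assume "?e f \<in> Units (group_ring G)"
  then obtain u where u: "u \<in> carrier (group_ring G)" "?e f \<otimes>\<^bsub>group_ring G\<^esub> u = \<one>\<^bsub>group_ring G\<^esub>"
    by (auto simp: Units_def)
  \<comment> \<open>Restricting \<open>u\<close> to the subgroup generated by \<open>x\<close> is still a right inverse.\<close>
  define H where "H = range (\<lambda>i::nat. x [^] i)"
  define \<rho> where "\<rho> = frag_extend (\<lambda>h. if h \<in> H then frag_of h else 0)"
  have H: "x [^] (i::nat) \<otimes> y \<in> H \<longleftrightarrow> y \<in> H" if y: "y \<in> carrier G" for i y
  proof
    assume "y \<in> H"
    then show "x [^] i \<otimes> y \<in> H"
      using x by (auto simp: H_def nat_pow_mult)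
  next
    assume "x [^] i \<otimes> y \<in> H"
    then obtain j where j: "x [^] i \<otimes> y = x [^] (j::nat)"
      by (auto simp: H_def)
    have "x [^] (n * i) = \<one>"
      using x n pow_ord_eq_1[OF x] by (simp add: nat_pow_pow[symmetric])
    then have "y = x [^] (n * i - i) \<otimes> (x [^] i \<otimes> y)"
      using x y n by (simp add: m_assoc[symmetric] nat_pow_mult)
    then have "y = x [^] (n * i - i + j)"
      using x by (simp add: j nat_pow_mult)
    then show "y \<in> H" by (auto simp: H_def)
  qed
  have shift: "\<rho> (frag_of (x [^] (i::nat)) \<otimes>\<^bsub>group_ring G\<^esub> a) = frag_of (x [^] i) \<otimes>\<^bsub>group_ring G\<^esub> \<rho> a"
    if "a \<in> carrier (group_ring G)" for a i
  proof -
    have "Poly_Mapping.keys a \<subseteq> carrier G"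
      using that by (simp add: group_ring_simps)
    then show ?thesis
      by (induction a rule: frag_induction)
         (simp_all add: \<rho>_def group_ring_mult_diff group_ring_mult_0 group_ring_mult_of
           frag_extend_diff H)
  qed
  have mult: "\<rho> (?e p \<otimes>\<^bsub>group_ring G\<^esub> a) = ?e p \<otimes>\<^bsub>group_ring G\<^esub> \<rho> a"
    if "a \<in> carrier (group_ring G)" for a p
  proof -
    have "\<rho> (sum F I \<otimes>\<^bsub>group_ring G\<^esub> a) = sum F I \<otimes>\<^bsub>group_ring G\<^esub> \<rho> a"
      if "finite I" "\<And>i. i \<in> I \<Longrightarrow> \<rho> (F i \<otimes>\<^bsub>group_ring G\<^esub> a) = F i \<otimes>\<^bsub>group_ring G\<^esub> \<rho> a"
      for F and I :: "nat set"
      using that by (induction I rule: finite_induct)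
        (simp_all add: group_ring_mult_0 group_ring_mult_add \<rho>_def frag_extend_add)
    moreover have "\<rho> (frag_cmul k b) = frag_cmul k (\<rho> b)" for k b
      by (simp add: \<rho>_def frag_extend_cmul)
    ultimately show ?thesis
      unfolding group_ring_eval_eq[OF x] by (simp add: group_ring_cmul_mult shift that)
  qed
  have "Poly_Mapping.keys u \<subseteq> carrier G"
    using u by (simp add: group_ring_simps)
  then have "\<exists>g. \<rho> u = ?e g"
  proof (induction u rule: frag_induction)
    case zero
    show ?case
      by (rule exI[of _ 0]) (simp add: \<rho>_def group_ring_eval_eq x)
  next
    case (one y)
    show ?case
    proof (cases "y \<in> H")
      case True
      then obtain i :: nat where "y = x [^] i" by (auto simp: H_def)
      with True show ?thesis
        by (intro exI[of _ "Polynomial.monom 1 i"]) (simp add: \<rho>_def group_ring_eval_monom x)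
    next
      case False
      then show ?thesis
        by (intro exI[of _ 0]) (simp add: \<rho>_def group_ring_eval_eq x)
    qed
  next
    case (diff a b)
    then obtain p q where "\<rho> a = ?e p" "\<rho> b = ?e q" by blast
    then show ?case
      by (intro exI[of _ "p - q"]) (simp add: \<rho>_def frag_extend_diff group_ring_eval_diff x)
  qed
  then obtain g where g: "\<rho> u = ?e g" ..
  have "\<one> \<in> H"
    unfolding H_def by (metis nat_pow_0 rangeI)
  then have "\<rho> \<one>\<^bsub>group_ring G\<^esub> = \<one>\<^bsub>group_ring G\<^esub>"
    by (simp add: \<rho>_def group_ring_simps)
  then have "?e (f * g) = \<one>\<^bsub>group_ring G\<^esub>"
    using mult[OF u(1), of f] u(2) g by (simp add: group_ring_eval_mult x)
  then have "?e (f * g - 1) = 0"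
    by (simp add: group_ring_eval_diff group_ring_eval_one x)
  then show "\<exists>g. (Polynomial.monom 1 n - 1) dvd (f * g - 1)"
    using group_ring_eval_eq_0_iff[OF assms] by blast
qed

end

lemma ex_int_group_order:
  assumes "n > 0"
  shows "\<exists>(G :: int monoid) x. group G \<and> x \<in> carrier G \<and> group.ord G x = n"
proof -
  interpret Z: group "integer_mod_group n" by simp
  define x where "x = 1 mod int n"
  have x: "x \<in> carrier (integer_mod_group n)"
    using assms by (simp add: x_def carrier_integer_mod_group)
  have pow: "x [^]\<^bsub>integer_mod_group n\<^esub> (k::nat) = int k mod int n" for k
    by (induction k) (simp_all add: x_def mod_simps add.commute)
  have "x [^]\<^bsub>integer_mod_group n\<^esub> k = \<one>\<^bsub>integer_mod_group n\<^esub> \<longleftrightarrow> n dvd k" for k :: nat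
    by (simp only: pow one_integer_mod_group) (simp add: mod_eq_0_iff_dvd)
  then have "Z.ord x = n"
    using x by (simp only: Z.ord_unique) blast
  with x show ?thesis
    using Z.is_group by blast
qed

text \<open>
  The class of \<open>f\<close> is a unit of \<open>\<int>[X]/(X\<^sup>n - 1)\<close>.
\<close>

lemma defines_unit_on_order_iff_quotient:
  assumes "n > 0"
  shows "defines_unit_on_order f n \<longleftrightarrow> (\<exists>g. (Polynomial.monom 1 n - 1) dvd (f * g - 1))"
  unfolding defines_unit_on_order_def
  using ex_int_group_order[OF assms] group.group_ring_eval_unit_iff[OF _ _ _ assms] by metis

lemma defines_unit_on_order_iff:
  assumes "group G" "x \<in> carrier G" "group.ord G x = n" "n > 0"
  shows "defines_unit_on_order f n \<longleftrightarrow>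
    int_poly_eval (group_ring G) f (frag_of x) \<in> Units (group_ring G)"
  using group.group_ring_eval_unit_iff[OF assms] defines_unit_on_order_iff_quotient[OF assms(4)]
  by simp

end

theory Submission
  imports Defs "Jordan_Normal_Form.Char_Poly"
begin

text \<open>
  The polynomial \<open>f\<close> defines a unit on order \<open>n\<close> iff the integer \<open>N n = \<Prod> f(z)\<close>, the product over
  all \<open>n\<close>-th roots of unity \<open>z\<close>, is \<open>\<plusminus>1\<close>: it is the determinant of multiplication by \<open>f\<close> on
  \<open>\<int>[X]/(X\<^sup>n - 1)\<close>. If \<open>f(0) \<noteq> 0\<close> and \<open>f\<close> has degree \<open>d\<close> and leading coefficient \<open>c\<close>, then up to sign
  \<open>c\<^sup>n\<^sup>d N n = c\<^sup>n det (M\<^sup>n - c\<^sup>n)\<close> for an integer \<open>d \<times> d\<close> matrix \<open>M\<close> with \<open>det M \<noteq> 0\<close>, so that the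
  dependence on \<open>n\<close> is through powers of matrices of a fixed size. For a prime \<open>p\<close> dividing neither
  \<open>c\<close> nor \<open>det M\<close> there is an \<open>m > 0\<close> with \<open>M\<^sup>m \<equiv> 1\<close> and \<open>c\<^sup>m \<equiv> 1\<close> modulo \<open>p\<^sup>2\<close>. Along each residue class
  \<open>n = r + m k\<close> the condition \<open>N n = \<plusminus>1\<close> then says that a function of \<open>k\<close> vanishes whose \<open>i\<close>-th
  differences are divisible by \<open>p\<^sup>2\<^sup>i\<close>, and such a function is zero as soon as it has infinitely many
  zeros (the Skolem-Mahler-Lech argument). Hence infinitely many unit orders force all \<open>r + m k\<close> to
  be unit orders for some \<open>r\<close>. Unit orders are closed under divisors, and every \<open>n\<close> coprime to \<open>m\<close>
  divides some \<open>r + m k\<close>.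
\<close>

hide_const (open) UnivPoly.coeff UnivPoly.monom Divisibility.prime

section \<open>Functions with small Newton differences\<close>

text \<open>Up to \<open>p * m\<close> there are \<open>m\<close> multiples of \<open>p\<close>,
  which contribute \<open>m\<close> plus the exponent of \<open>fact m\<close>; fewer than
  \<open>p\<close> further factors add nothing. By induction the exponent is at most
  \<open>2 * (i div p)\<close>, hence at most \<open>i\<close>.\<close>

lemma multiplicity_prime_fact_le:
  fixes p :: nat
  assumes p: "prime p"
  shows "multiplicity p (fact i :: nat) \<le> i"
proof (induction i rule: less_induct)
  case (less i)
  have p1: "p > 1" using p by (rule prime_gt_1_nat)
  have skip: "multiplicity p (fact (p * m + r) :: nat) = multiplicity p (fact (p * m) :: nat)"
    if "r < p" for m r
    using that
  proof (induction r)
    case (Suc r)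
    have "\<not> p dvd Suc r"
      using Suc.prems by (auto dest: dvd_imp_le)
    then have "\<not> p dvd Suc (p * m + r)"
      using dvd_add_right_iff[of p "p * m" "Suc r"] by simp
    then have "multiplicity p (Suc (p * m + r)) = 0"
      by (rule not_dvd_imp_multiplicity_0)
    then show ?case
      using Suc p by (simp only: add_Suc_right fact_Suc of_nat_id) (simp add: prime_elem_multiplicity_mult_distrib del: mult_Suc)
  qed simp
  have mult: "multiplicity p (fact (p * m) :: nat) = m + multiplicity p (fact m :: nat)" for m
  proof (induction m)
    case (Suc m)
    have "p * Suc m = Suc (p * m + (p - 1))" using p1 by simp
    then have "(fact (p * Suc m) :: nat) = p * Suc m * fact (p * m + (p - 1))"
      by (metis fact_Suc of_nat_id)
    then have "multiplicity p (fact (p * Suc m) :: nat) =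
        1 + multiplicity p (Suc m) + multiplicity p (fact (p * m) :: nat)"
      using p p1 skip[of "p - 1" m] by (simp add: prime_elem_multiplicity_mult_distrib del: mult_Suc_right)
    also have "\<dots> = Suc m + multiplicity p (fact (Suc m) :: nat)"
      by (simp only: fact_Suc of_nat_id) (simp add: Suc p prime_elem_multiplicity_mult_distrib del: mult_Suc)
    finally show ?case .
  qed simp
  show ?case
  proof (cases "i = 0")
    case False
    have "multiplicity p (fact i :: nat) = multiplicity p (fact (p * (i div p)) :: nat)"
      using skip[of "i mod p" "i div p"] p1 by simp
    also have "\<dots> \<le> i div p + i div p"
      unfolding mult using less[of "i div p"] False p1 by simp
    also have "\<dots> \<le> i"
      using p1 by (metis Suc_leI add_mono_thms_linordered_semiring(1) div_le_mono2 
          div_times_less_eq_dividend le_trans less_numeral_extra(1) mult_2 mult.commute one_add_one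
          plus_1_eq_Suc zero_less_numeral mult_le_mono order_refl)
    finally show ?thesis .
  qed simp
qed

text \<open>For clearing denominators in a Newton series: of the factor \<open>p ^ (2 * i)\<close>
  in the \<open>i\<close>-th difference, division by \<open>fact i\<close> can consume at most
  \<open>p ^ i\<close>, so a surplus \<open>p ^ i\<close> remains beyond the \<open>p\<close>-part
  of \<open>fact n\<close>.\<close>

lemma prime_power_dvd_fact_div_fact:
  fixes p :: nat
  assumes p: "prime p" and "i \<le> n"
  shows "p ^ (multiplicity p (fact n :: nat) + i) dvd (fact n div fact i) * p ^ (2 * i)"
proof -
  let ?t = "fact n div fact i :: nat"
  have t: "(fact n :: nat) = fact i * ?t"
    using fact_dvd[OF assms(2), where 'a = nat] by (metis dvd_mult_div_cancel)
  have "?t \<noteq> 0" using t by (metis fact_nonzero mult_0_right)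
  then have "multiplicity p (fact n :: nat) = multiplicity p (fact i :: nat) + multiplicity p ?t"
    using p by (subst t) (simp add: prime_elem_multiplicity_mult_distrib)
  then have "multiplicity p (fact n :: nat) + i \<le> multiplicity p ?t + 2 * i"
    using multiplicity_prime_fact_le[OF p, of i] by simp
  then have "p ^ (multiplicity p (fact n :: nat) + i) dvd p ^ (multiplicity p ?t + 2 * i)"
    by (rule le_imp_power_dvd)
  also have "\<dots> dvd ?t * p ^ (2 * i)"
    unfolding power_add by (intro mult_dvd_mono multiplicity_dvd dvd_refl)
  finally show ?thesis .
qed

section \<open>Monic division and polynomials with many roots\<close>

lemma monic_divmod:
  fixes p g :: "'a :: idom poly"
  assumes "lead_coeff g = 1"
  obtains q r where "p = g * q + r" "\<And>i. i \<ge> degree g \<Longrightarrow> coeff r i = 0"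
proof -
  obtain q r where qr: "pseudo_divmod p g = (q, r)" by fastforce
  have "g \<noteq> 0" using assms by auto
  from pseudo_divmod[OF this qr] have "p = g * q + r" "r = 0 \<or> degree r < degree g"
    by (simp_all add: assms)
  then show ?thesis by (intro that) (auto simp: coeff_eq_0)
qed

lemma poly_eq_0_if_many_roots:
  fixes p :: "'a :: idom poly"
  assumes "finite Z" "\<And>z. z \<in> Z \<Longrightarrow> poly p z = 0" "\<And>i. i \<ge> card Z \<Longrightarrow> coeff p i = 0"
  shows "p = 0"
proof (rule ccontr)
  assume p: "p \<noteq> 0"
  have "card Z \<le> card {x. poly p x = 0}"
    using assms by (intro card_mono poly_roots_finite p) auto
  also have "\<dots> \<le> degree p" by (rule card_poly_roots_bound) fact
  finally have "lead_coeff p = 0" by (rule assms)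
  with p show False by simp
qed

text \<open>This is \<open>fact i\<close> times the binomial polynomial; without that denominator it
  stays in the integer polynomials, where divisibility of coefficients makes sense.\<close>

definition ffact_poly :: "nat \<Rightarrow> int poly" where
  "ffact_poly i = (\<Prod>j<i. [:- int j, 1:])"

lemma degree_ffact_poly: "degree (ffact_poly i) = i"
  unfolding ffact_poly_def by (subst degree_prod_eq_sum_degree) auto

lemma poly_ffact_poly: "poly (ffact_poly i) (int x) = fact i * int (x choose i)"
proof (induction i)
  case (Suc i)
  have "Suc i * (x choose Suc i) = (x - i) * (x choose i)"
  proof (cases x)
    case (Suc n)
    then show ?thesis
      using binomial_absorption[of i x] binomial_absorb_comp[of x i] by simp
  qed simp
  then have "int (Suc i) * int (x choose Suc i) = int ((x - i) * (x choose i))"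
    by (metis of_nat_mult)
  also have "\<dots> = (int x - int i) * int (x choose i)"
    by (cases "i \<le> x") (auto simp: of_nat_diff)
  finally have "int (Suc i) * int (x choose Suc i) = (int x - int i) * int (x choose i)" .
  then have "fact i * (int (Suc i) * int (x choose Suc i)) = fact i * ((int x - int i) * int (x choose i))"
    by simp
  moreover have "poly (ffact_poly (Suc i)) (int x) = poly (ffact_poly i) (int x) * (int x - int i)"
    by (simp add: ffact_poly_def algebra_simps)
  ultimately show ?case
    using Suc.IH by (simp add: algebra_simps)
qed (simp add: ffact_poly_def)

text \<open>Dividing by the monic polynomial with root set \<open>Z\<close> loses no divisibility in the high
  coefficients, and the remainder vanishes because it has too many roots.\<close>

lemma dvd_poly_if_many_roots:
  fixes a :: "nat \<Rightarrow> int" and n :: nat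
  defines "P \<equiv> \<Sum>i\<le>n. smult (a i) (ffact_poly i)"
  assumes Z: "finite Z" "\<And>z. z \<in> Z \<Longrightarrow> poly P z = 0"
    and a: "\<And>i. card Z \<le> i \<Longrightarrow> i \<le> n \<Longrightarrow> m dvd a i"
  shows "m dvd poly P t"
proof -
  let ?K = "card Z"
  define L where "L = (\<Prod>z\<in>Z. [:- z, 1:])"
  define lo where "lo = (\<Sum>i\<in>{i. i \<le> n \<and> i < ?K}. smult (a i) (ffact_poly i))"
  define hi where "hi = (\<Sum>i\<in>{i. i \<le> n \<and> ?K \<le> i}. smult (a i div m) (ffact_poly i))"
  have "P = lo + (\<Sum>i\<in>{i. i \<le> n \<and> ?K \<le> i}. smult (a i) (ffact_poly i))"
    unfolding P_def lo_def by (subst sum.union_disjoint[symmetric]) (auto intro!: sum.cong)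
  also have "(\<Sum>i\<in>{i. i \<le> n \<and> ?K \<le> i}. smult (a i) (ffact_poly i)) = smult m hi"
    unfolding hi_def smult_sum2 using a by (intro sum.cong) auto
  finally have P: "P = lo + smult m hi" .
  have deg: "degree L = ?K"
    unfolding L_def by (subst degree_prod_eq_sum_degree) auto
  have "lead_coeff L = 1"
    unfolding L_def by (simp add: lead_coeff_prod)
  then obtain q r where qr: "hi = L * q + r" "\<And>i. i \<ge> ?K \<Longrightarrow> coeff r i = 0"
    using monic_divmod[of L hi] deg by metis
  have L0: "poly L z = 0" if "z \<in> Z" for z
    using that Z(1) by (auto simp: L_def poly_prod)
  have "lo + smult m r = 0"
  proof (rule poly_eq_0_if_many_roots[OF Z(1)])
    fix z assume "z \<in> Z"
    then show "poly (lo + smult m r) z = 0"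
      using Z(2)[of z] L0[of z] by (simp add: P qr)
  next
    fix i assume i: "i \<ge> ?K"
    then have "coeff (ffact_poly j) i = 0" if "j < ?K" for j
      using that by (intro coeff_eq_0) (simp add: degree_ffact_poly)
    then have "coeff lo i = 0"
      unfolding lo_def coeff_sum by (intro sum.neutral) auto
    then show "coeff (lo + smult m r) i = 0"
      using qr i by simp
  qed
  then have "P = smult m (L * q)"
    by (simp add: P qr smult_add_right add_eq_0_iff2)
  then show ?thesis by simp
qed

section \<open>Finite differences and Newton series\<close>

definition fdiff :: "(nat \<Rightarrow> int) \<Rightarrow> nat \<Rightarrow> int" where
  "fdiff F k = F (Suc k) - F k"

text \<open>For \<open>q = p ^ 2\<close> this is a discrete substitute for p-adic analyticity: the
  Newton coefficients keep growing powers of \<open>p\<close> even after division by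
  \<open>fact i\<close>.\<close>

definition newton_small :: "int \<Rightarrow> (nat \<Rightarrow> int) \<Rightarrow> bool" where
  "newton_small q F \<longleftrightarrow> (\<forall>i k. q ^ i dvd (fdiff ^^ i) F k)"

lemma fdiff_funpow_mult: "(fdiff ^^ i) (\<lambda>k. c * F k) = (\<lambda>k. c * (fdiff ^^ i) F k)"
  by (induction i) (auto simp: fdiff_def fun_eq_iff algebra_simps)

lemma fdiff_funpow_add: "(fdiff ^^ i) (\<lambda>k. F k + G k) = (\<lambda>k. (fdiff ^^ i) F k + (fdiff ^^ i) G k)"
  by (induction i) (auto simp: fdiff_def fun_eq_iff algebra_simps)

text \<open>The base point is free in the induction: a difference at \<open>Suc m\<close> is the sum
  of two consecutive ones at \<open>m\<close>, and Pascal's rule collects the coefficients.\<close>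

lemma newton_forward: "F (m + k) = (\<Sum>i\<le>k. int (k choose i) * (fdiff ^^ i) F m)"
proof (induction k arbitrary: m)
  case (Suc k)
  let ?a = "\<lambda>i. (fdiff ^^ i) F m"
  have "F (m + Suc k) = (\<Sum>i\<le>k. int (k choose i) * (fdiff ^^ i) F (Suc m))"
    using Suc[of "Suc m"] by simp
  also have "\<dots> = (\<Sum>i\<le>k. int (k choose i) * ?a i) + (\<Sum>i\<le>k. int (k choose i) * ?a (Suc i))"
    by (simp add: fdiff_def sum.distrib[symmetric] algebra_simps)
  also have "(\<Sum>i\<le>k. int (k choose i) * ?a i) = (\<Sum>i\<le>Suc k. int (k choose i) * ?a i)"
    by simp
  also have "\<dots> = ?a 0 + (\<Sum>i\<le>k. int (k choose Suc i) * ?a (Suc i))"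
    by (subst sum.atMost_Suc_shift) simp
  also have "\<dots> + (\<Sum>i\<le>k. int (k choose i) * ?a (Suc i)) = (\<Sum>i\<le>Suc k. int (Suc k choose i) * ?a i)"
    by (subst sum.atMost_Suc_shift) (simp add: sum.distrib algebra_simps)
  finally show ?case .
qed simp

text \<open>The class is stable under taking a difference and dividing it by \<open>q\<close>. This
  recursive form permits induction on the order of the difference, as needed for products.\<close>

lemma newton_small_iff:
  assumes "q \<noteq> 0"
  shows "newton_small q F \<longleftrightarrow> (\<exists>G. newton_small q G \<and> fdiff F = (\<lambda>k. q * G k))"
proof
  assume F: "newton_small q F"
  define G where "G k = fdiff F k div q" for k
  have "q dvd fdiff F k" for k
    using F[unfolded newton_small_def, rule_format, of 1 k] by simp
  then have G: "fdiff F = (\<lambda>k. q * G k)"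
    by (simp add: G_def fun_eq_iff)
  have "q * q ^ i dvd q * (fdiff ^^ i) G k" for i k
    using F[unfolded newton_small_def, rule_format, of "Suc i" k]
    by (simp add: funpow_Suc_right G fdiff_funpow_mult del: funpow.simps)
  then have "newton_small q G"
    using assms by (simp add: newton_small_def)
  with G show "\<exists>G. newton_small q G \<and> fdiff F = (\<lambda>k. q * G k)" by blast
next
  assume "\<exists>G. newton_small q G \<and> fdiff F = (\<lambda>k. q * G k)"
  then obtain G where G: "newton_small q G" "fdiff F = (\<lambda>k. q * G k)" by blast
  have "q ^ i dvd (fdiff ^^ i) F k" for i k
  proof (cases i)
    case (Suc j)
    have "q * q ^ j dvd q * (fdiff ^^ j) G k"
      using G(1) by (simp add: newton_small_def)
    then show ?thesis
      by (simp add: Suc funpow_Suc_right G(2) fdiff_funpow_mult del: funpow.simps)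
  qed simp
  then show "newton_small q F" by (simp add: newton_small_def)
qed

lemma newton_small_const [simp]: "newton_small q (\<lambda>_. c)"
proof -
  have "(fdiff ^^ i) (\<lambda>_. 0) = (\<lambda>_. 0)" for i
    using fdiff_funpow_mult[of i 0 "\<lambda>_. 0"] by simp
  then have "q ^ i dvd (fdiff ^^ i) (\<lambda>_. c) k" for i k
    by (cases i) (simp_all add: funpow_Suc_right fdiff_def[abs_def] del: funpow.simps)
  then show ?thesis by (simp add: newton_small_def)
qed

lemma newton_small_add:
  "newton_small q F \<Longrightarrow> newton_small q G \<Longrightarrow> newton_small q (\<lambda>k. F k + G k)"
  by (simp add: newton_small_def fdiff_funpow_add)

text \<open>By the discrete Leibniz rule, the difference of a product is \<open>q\<close> times a
  combination of products of functions from the same class, with one difference fewer left to take.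
  The factors change at each step, so they are free in the induction.\<close>

lemma newton_small_mult:
  assumes q: "q \<noteq> 0" and "newton_small q F" "newton_small q G"
  shows "newton_small q (\<lambda>k. F k * G k)"
proof -
  have "q ^ i dvd (fdiff ^^ i) (\<lambda>k. F k * G k) k" if "newton_small q F" "newton_small q G" for F G i k
    using that
  proof (induction i arbitrary: F G)
    case (Suc i)
    obtain F' G' where F': "newton_small q F'" "fdiff F = (\<lambda>k. q * F' k)"
      and G': "newton_small q G'" "fdiff G = (\<lambda>k. q * G' k)"
      using Suc.prems newton_small_iff[OF q] by meson
    have "fdiff (\<lambda>k. F k * G k) = (\<lambda>k. fdiff F k * G k + F k * fdiff G k + fdiff F k * fdiff G k)"
      by (simp add: fdiff_def fun_eq_iff algebra_simps)
    also have "\<dots> = (\<lambda>k. q * (F' k * G k + F k * G' k + q * (F' k * G' k)))"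
      unfolding F' G' by (simp add: algebra_simps)
    finally have "(fdiff ^^ Suc i) (\<lambda>k. F k * G k) k = q * ((fdiff ^^ i) (\<lambda>k. F' k * G k) k +
        (fdiff ^^ i) (\<lambda>k. F k * G' k) k + q * (fdiff ^^ i) (\<lambda>k. F' k * G' k) k)"
      by (simp add: funpow_Suc_right fdiff_funpow_mult fdiff_funpow_add del: funpow.simps)
    moreover have "q ^ i dvd (fdiff ^^ i) (\<lambda>k. F' k * G k) k" "q ^ i dvd (fdiff ^^ i) (\<lambda>k. F k * G' k) k"
      "q ^ i dvd (fdiff ^^ i) (\<lambda>k. F' k * G' k) k"
      using Suc.prems F' G' by (auto intro!: Suc.IH)
    ultimately show ?case
      by (auto intro!: mult_dvd_mono dvd_add dvd_mult)
  qed simp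
  then show ?thesis
    using assms by (simp add: newton_small_def)
qed

lemma newton_small_diff:
  assumes "q \<noteq> 0" "newton_small q F" "newton_small q G"
  shows "newton_small q (\<lambda>k. F k - G k)"
  using newton_small_add[OF assms(2) newton_small_mult[OF assms(1) newton_small_const[of q "-1"] assms(3)]]
  by simp

lemma newton_small_power:
  "q \<noteq> 0 \<Longrightarrow> newton_small q F \<Longrightarrow> newton_small q (\<lambda>k. F k ^ m)"
  by (induction m) (auto intro: newton_small_mult)

lemma newton_small_sum:
  "(\<And>x. x \<in> I \<Longrightarrow> newton_small q (F x)) \<Longrightarrow> newton_small q (\<lambda>k. \<Sum>x\<in>I. F x k)"
  by (induction I rule: infinite_finite_induct) (auto intro: newton_small_add)

lemma newton_small_prod:
  assumes "q \<noteq> 0"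
  shows "(\<And>x. x \<in> I \<Longrightarrow> newton_small q (F x)) \<Longrightarrow> newton_small q (\<lambda>k. \<Prod>x\<in>I. F x k)"
  by (induction I rule: infinite_finite_induct) (auto intro!: newton_small_mult assms)

lemma int_eq_0_if_prime_powers_dvd:
  fixes x :: int
  assumes "prime p" "\<And>K. int p ^ K dvd x"
  shows "x = 0"
proof (rule ccontr)
  assume x: "x \<noteq> 0"
  have "int p ^ nat \<bar>x\<bar> \<le> \<bar>x\<bar>"
    using assms(2)[of "nat \<bar>x\<bar>"] x by (simp add: zdvd_imp_le)
  moreover have "nat \<bar>x\<bar> < p ^ nat \<bar>x\<bar>"
    using prime_gt_1_nat[OF assms(1)] by (intro power_gt_expt) simp
  then have "\<bar>x\<bar> < int p ^ nat \<bar>x\<bar>"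
    by (metis int_nat_eq abs_ge_zero of_nat_less_iff of_nat_power)
  ultimately show False by simp
qed

text \<open>Hansel's elementary form of Skolem's \<open>p\<close>-adic argument.\<close>

lemma newton_small_infinite_zeros:
  assumes p: "prime p" and F: "newton_small (int p ^ 2) F" and inf: "infinite {k. F k = 0}"
  shows "F t = 0"
proof (rule int_eq_0_if_prime_powers_dvd[OF p])
  fix K
  \<comment> \<open>\<open>K\<close> zeros allow division by a monic polynomial of degree
    \<open>K\<close>; only Newton coefficients of index at least \<open>K\<close> then count, and
    these have a surplus of at least \<open>p ^ K\<close>.\<close>
  obtain Z where Z: "Z \<subseteq> {k. F k = 0}" "finite Z" "card Z = K"
    using infinite_arbitrarily_large[OF inf] by blast
  define n where "n = Max (insert t Z)"
  \<comment> \<open>Newton's series multiplied by \<open>fact n\<close>: the quotient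
    \<open>fact n div fact i\<close> compensates the \<open>fact i\<close> inside
    \<open>ffact_poly i\<close>. The resulting \<open>P\<close> agrees with
    \<open>fact n * F\<close> on all of \<open>0..n\<close>, which contains \<open>t\<close> and
    \<open>Z\<close>.\<close>
  define a where "a i = int (fact n div fact i) * (fdiff ^^ i) F 0" for i
  define v where "v = multiplicity p (fact n :: nat)"
  define P where "P = (\<Sum>i\<le>n. smult (a i) (ffact_poly i))"
  have P: "poly P (int x) = fact n * F x" if "x \<le> n" for x
  proof -
    have "F x = (\<Sum>i\<le>x. int (x choose i) * (fdiff ^^ i) F 0)"
      using newton_forward[of F 0 x] by simp
    also have "\<dots> = (\<Sum>i\<le>n. int (x choose i) * (fdiff ^^ i) F 0)"
      using that by (intro sum.mono_neutral_left) auto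
    finally have "fact n * F x = (\<Sum>i\<le>n. fact n * (int (x choose i) * (fdiff ^^ i) F 0))"
      by (simp add: sum_distrib_left)
    also have "\<dots> = (\<Sum>i\<le>n. a i * (fact i * int (x choose i)))"
    proof (intro sum.cong refl)
      fix i assume "i \<in> {..n}"
      then have "(fact n :: nat) = fact n div fact i * fact i"
        by (simp add: fact_dvd)
      then have "(fact n :: int) = int (fact n div fact i) * fact i"
        by (metis of_nat_fact of_nat_mult)
      then show "fact n * (int (x choose i) * (fdiff ^^ i) F 0) = a i * (fact i * int (x choose i))"
        by (simp add: a_def algebra_simps)
    qed
    also have "\<dots> = poly P (int x)"
      by (simp add: P_def poly_sum poly_ffact_poly)
    finally show ?thesis by simp
  qed
  have le: "x \<le> n" if "x \<in> insert t Z" for x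
    using that Z(2) unfolding n_def by (intro Max_ge) auto
  \<comment> \<open>The part \<open>p ^ v\<close> is lost again when \<open>fact n\<close> is
    cancelled, leaving \<open>p ^ K\<close>.\<close>
  have "int p ^ (v + K) dvd poly P (int t)"
    unfolding P_def
  proof (rule dvd_poly_if_many_roots)
    show "finite (int ` Z)" using Z by simp
    show "poly (\<Sum>i\<le>n. smult (a i) (ffact_poly i)) z = 0" if "z \<in> int ` Z" for z
      using that P le Z(1) unfolding P_def by auto
    fix i assume "card (int ` Z) \<le> i" "i \<le> n"
    then have i: "K \<le> i" "i \<le> n" using Z by (simp_all add: card_image)
    have "int p ^ (v + K) dvd int p ^ (v + i)"
      using i by (intro le_imp_power_dvd) simp
    also have "\<dots> dvd int (fact n div fact i) * (int p ^ 2) ^ i"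
      using prime_power_dvd_fact_div_fact[OF p i(2)] unfolding v_def
      by (metis of_nat_dvd_iff of_nat_mult of_nat_power power_mult)
    also have "\<dots> dvd a i"
      unfolding a_def using F by (intro mult_dvd_mono) (simp_all add: newton_small_def)
    finally show "int p ^ (v + K) dvd a i" .
  qed
  then have *: "int p ^ (v + K) dvd fact n * F t"
    using P[of t] le[of t] by simp
  obtain w where w: "(fact n :: nat) = p ^ v * w" "\<not> p dvd w"
    using multiplicity_decompose'[of "fact n :: nat" p] p unfolding v_def
    by (metis fact_nonzero not_prime_unit)
  have "(fact n :: int) = int p ^ v * int w"
    using w(1) by (metis of_nat_fact of_nat_mult of_nat_power)
  with * have "int p ^ K dvd int w * F t"
    using prime_gt_0_nat[OF p] by (simp add: power_add mult.assoc)
  moreover have "coprime (int p ^ K) (int w)"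
    using w(2) p by (simp add: prime_imp_coprime_nat)
  ultimately show "int p ^ K dvd F t"
    by (simp add: coprime_dvd_mult_right_iff)
qed

section \<open>Powers of integer matrices modulo an integer\<close>

lemma pow_mat_add:
  assumes A: "A \<in> carrier_mat n n"
  shows "A ^\<^sub>m (k + l) = A ^\<^sub>m k * A ^\<^sub>m l"
proof (induction l)
  case 0
  show ?case using right_mult_one_mat[of "A ^\<^sub>m k" n n] A by simp
next
  case (Suc l)
  then show ?case using A by (simp add: assoc_mult_mat[of _ n n _ n _ n])
qed

lemma pow_mat_mult:
  assumes A: "A \<in> carrier_mat n n"
  shows "A ^\<^sub>m (k * l) = (A ^\<^sub>m k) ^\<^sub>m l"
proof (induction l)
  case (Suc l)
  then show ?case by (simp only: mult_Suc_right add.commute[of k] pow_mat_add[OF A] pow_mat.simps)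
qed (use A in auto)

lemma det_pow_mat:
  assumes A: "A \<in> carrier_mat n n"
  shows "det (A ^\<^sub>m k) = det A ^ k"
  by (induction k) (use A in \<open>auto simp: det_mult[of _ n] mult.commute\<close>)

text \<open>The matrix \<open>A\<close> is cancelled modulo \<open>q\<close> by multiplying with its
  adjugate, which leaves the factor \<open>det A\<close>, a unit modulo \<open>q\<close>.\<close>

lemma dvd_mat_entries_if_dvd_mult:
  fixes A Y :: "int mat"
  assumes A: "A \<in> carrier_mat n n" and Y: "Y \<in> carrier_mat n n" and cop: "coprime q (det A)"
    and dvd: "\<And>i j. i < n \<Longrightarrow> j < n \<Longrightarrow> q dvd (A * Y) $$ (i,j)"
    and ij: "i < n" "j < n"
  shows "q dvd Y $$ (i,j)"
proof -
  have adj: "adj_mat A \<in> carrier_mat n n" by (rule adj_mat(1)[OF A])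
  have "adj_mat A * (A * Y) = (adj_mat A * A) * Y"
    using A Y adj by (simp add: assoc_mult_mat[of _ n n _ n _ n])
  also have "\<dots> = det A \<cdot>\<^sub>m Y"
    using Y by (simp add: adj_mat(3)[OF A] mult_smult_assoc_mat[of _ n n _ n])
  finally have "det A * Y $$ (i,j) = (adj_mat A * (A * Y)) $$ (i,j)"
    using Y ij by simp
  also have "\<dots> = (\<Sum>k<n. adj_mat A $$ (i,k) * (A * Y) $$ (k,j))"
    using A Y adj ij
    by (simp add: scalar_prod_def atLeast0LessThan)
  also have "q dvd \<dots>"
    using dvd ij by (intro dvd_sum dvd_mult) auto
  finally show ?thesis
    using cop by (simp add: coprime_dvd_mult_right_iff)
qed

text \<open>Pigeonhole on the residues modulo \<open>q\<close>: two exponents agree, and the smaller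
  power is cancelled. Recording \<open>A ^\<^sub>m k\<close> and \<open>c ^ k\<close> as a pair
  gives one \<open>N\<close> for both.\<close>

lemma mat_power_cong_one:
  fixes A :: "int mat" and q c :: int
  assumes A: "A \<in> carrier_mat n n" and q: "q > 0" and cop: "coprime q (det A)" "coprime q c"
  obtains N B where "N > 0" "B \<in> carrier_mat n n" "A ^\<^sub>m N = 1\<^sub>m n + q \<cdot>\<^sub>m B" "q dvd c ^ N - 1"
proof -
  define S where "S = {..<n} \<times> {..<n}"
  define h where "h k = (restrict (\<lambda>ij. (A ^\<^sub>m k) $$ ij mod q) S, c ^ k mod q)" for k
  have "range h \<subseteq> (S \<rightarrow>\<^sub>E {0..<q}) \<times> {0..<q}"
    using q by (auto simp: h_def)
  then have "finite (range h)"
    by (rule finite_subset) (auto simp: S_def intro!: finite_PiE)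
  then have "\<not> inj h"
    using finite_imageD infinite_UNIV_nat by blast
  then obtain a b where ab: "h a = h b" "a < b"
    unfolding inj_def by (metis linorder_neqE_nat)
  define N where "N = b - a"
  have b: "b = a + N" using ab by (simp add: N_def)
  define Y where "Y = A ^\<^sub>m N - 1\<^sub>m n"
  have Y: "Y \<in> carrier_mat n n" unfolding Y_def by (rule minus_carrier_mat) simp
  have dvd: "q dvd Y $$ (i,j)" if "i < n" "j < n" for i j
  proof (rule dvd_mat_entries_if_dvd_mult[of "A ^\<^sub>m a"])
    show "coprime q (det (A ^\<^sub>m a))"
      using cop by (simp add: det_pow_mat[OF A])
    have AY: "A ^\<^sub>m a * Y = A ^\<^sub>m b - A ^\<^sub>m a"
      using A unfolding Y_def b
      by (subst mult_minus_distrib_mat[of _ n n _ n]) (auto simp: pow_mat_add)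
    fix i j assume ij: "i < n" "j < n"
    have "fst (h a) (i,j) = fst (h b) (i,j)" using ab by simp
    then have "(A ^\<^sub>m b) $$ (i,j) mod q = (A ^\<^sub>m a) $$ (i,j) mod q"
      using ij by (simp add: h_def S_def)
    then show "q dvd (A ^\<^sub>m a * Y) $$ (i,j)"
      using ij A by (simp add: AY mod_eq_dvd_iff)
  qed (use that Y A in auto)
  define B where "B = mat n n (\<lambda>ij. Y $$ ij div q)"
  show ?thesis
  proof
    show "N > 0" using ab by (simp add: N_def)
    show "B \<in> carrier_mat n n" by (simp add: B_def)
    show "A ^\<^sub>m N = 1\<^sub>m n + q \<cdot>\<^sub>m B"
    proof (rule eq_matI)
      fix i j assume "i < dim_row (1\<^sub>m n + q \<cdot>\<^sub>m B)" "j < dim_col (1\<^sub>m n + q \<cdot>\<^sub>m B)"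
      then have ij: "i < n" "j < n" by (auto simp: B_def)
      have "(1\<^sub>m n + q \<cdot>\<^sub>m B) $$ (i,j) = 1\<^sub>m n $$ (i,j) + Y $$ (i,j)"
        using ij dvd[OF ij] by (simp add: B_def)
      also have "\<dots> = (A ^\<^sub>m N) $$ (i,j)"
        using ij A by (simp add: Y_def)
      finally show "(A ^\<^sub>m N) $$ (i,j) = (1\<^sub>m n + q \<cdot>\<^sub>m B) $$ (i,j)" ..
    qed (use A in \<open>auto simp: B_def\<close>)
    have "c ^ b mod q = c ^ a mod q"
      using ab by (simp add: h_def)
    then have "q dvd c ^ a * (c ^ N - 1)"
      by (simp add: b mod_eq_dvd_iff power_add algebra_simps)
    then show "q dvd c ^ N - 1"
      using cop by (simp add: coprime_dvd_mult_right_iff)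
  qed
qed

lemma newton_small_geometric:
  assumes "q dvd a - 1"
  shows "newton_small q (\<lambda>k. x * a ^ k)"
proof -
  have "(fdiff ^^ i) (\<lambda>k. x * a ^ k) = (\<lambda>k. (a - 1) ^ i * (x * a ^ k))" for i
    by (induction i) (auto simp: fdiff_def fun_eq_iff algebra_simps)
  then show ?thesis
    using dvd_power_same[OF assms] by (simp add: newton_small_def dvd_mult2)
qed

text \<open>A difference replaces \<open>C\<close> by \<open>B * C\<close> and brings out a factor
  \<open>q\<close>, so \<open>C\<close> is free in the induction. The factor \<open>C\<close> also
  accommodates the offset of a residue class.\<close>

lemma newton_small_mat_power:
  fixes A B C :: "int mat" and q :: int
  assumes B: "B \<in> carrier_mat n n" and A: "A = 1\<^sub>m n + q \<cdot>\<^sub>m B" and C: "C \<in> carrier_mat n n"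
    and ij: "i < n" "j < n"
  shows "newton_small q (\<lambda>k. (A ^\<^sub>m k * C) $$ (i,j))"
proof -
  have Ac: "A \<in> carrier_mat n n" using A B by simp
  have "q ^ m dvd (fdiff ^^ m) (\<lambda>k. (A ^\<^sub>m k * C) $$ (i,j)) k" if "C \<in> carrier_mat n n" for m k C
    using that
  proof (induction m arbitrary: C)
    case (Suc m)
    have BC: "B * C \<in> carrier_mat n n" using B Suc.prems by simp
    have "fdiff (\<lambda>k. (A ^\<^sub>m k * C) $$ (i,j)) = (\<lambda>k. q * (A ^\<^sub>m k * (B * C)) $$ (i,j))"
    proof
      fix k
      have P: "A ^\<^sub>m k \<in> carrier_mat n n" using Ac by simp
      have "A * C = C + q \<cdot>\<^sub>m (B * C)"
        unfolding A using B Suc.prems by (simp add: add_mult_distrib_mat[of _ n n _ _ n] mult_smult_assoc_mat[of _ n n _ n])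
      then have "A ^\<^sub>m Suc k * C = A ^\<^sub>m k * (C + q \<cdot>\<^sub>m (B * C))"
        using P Ac Suc.prems by (simp add: assoc_mult_mat[of _ n n _ n _ n])
      also have "\<dots> = A ^\<^sub>m k * C + q \<cdot>\<^sub>m (A ^\<^sub>m k * (B * C))"
        using P BC Suc.prems by (simp add: mult_add_distrib_mat[of _ n n _ n] mult_smult_distrib[of _ n n _ n])
      finally have "(A ^\<^sub>m Suc k * C) $$ (i,j) = (A ^\<^sub>m k * C + q \<cdot>\<^sub>m (A ^\<^sub>m k * (B * C))) $$ (i,j)"
        by (rule arg_cong)
      also have "\<dots> = (A ^\<^sub>m k * C) $$ (i,j) + q * (A ^\<^sub>m k * (B * C)) $$ (i,j)"
        using P Ac B Suc.prems ij by (subst index_add_mat) auto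
      finally show "fdiff (\<lambda>k. (A ^\<^sub>m k * C) $$ (i,j)) k = q * (A ^\<^sub>m k * (B * C)) $$ (i,j)"
        by (simp only: fdiff_def)
    qed
    then show ?case
      using Suc.IH[OF BC]
      by (simp add: funpow_Suc_right fdiff_funpow_mult mult_dvd_mono del: funpow.simps)
  qed simp
  then show ?thesis using C by (simp add: newton_small_def)
qed

lemma newton_small_det:
  assumes "q \<noteq> 0" and "\<And>k. A k \<in> carrier_mat n n"
    and "\<And>i j. i < n \<Longrightarrow> j < n \<Longrightarrow> newton_small q (\<lambda>k. A k $$ (i,j))"
  shows "newton_small q (\<lambda>k. det (A k))"
proof -
  have "newton_small q (\<lambda>k. \<Sum>p\<in>{p. p permutes {0..<n}}. signof p * (\<Prod>i = 0..<n. A k $$ (i, p i)))"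
    using assms
    by (intro newton_small_sum newton_small_mult[OF assms(1)] newton_small_prod[OF assms(1)] newton_small_const)
       (auto simp: permutes_in_image)
  then show ?thesis
    by (simp add: det_def'[OF assms(2)])
qed

text \<open>\<open>F\<close> is built from entries of matrix powers and powers of \<open>c\<close>
  by ring operations, so along each class modulo \<open>N\<close> it is \<open>newton_small\<close>.
  The same \<open>N\<close> serves all offsets \<open>r\<close>.\<close>

lemma det_power_periodic_zeros:
  fixes M :: "int mat" and c :: int and a b :: nat
  assumes M: "M \<in> carrier_mat n n" and det: "det M \<noteq> 0" and c: "c \<noteq> 0"
  defines "F \<equiv> \<lambda>m. (det (M ^\<^sub>m m - c ^ m \<cdot>\<^sub>m 1\<^sub>m n))\<^sup>2 * (c ^ m) ^ a - (c ^ m) ^ b"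
  obtains N where "N > 0" "\<forall>r k. infinite {k. F (r + N * k) = 0} \<longrightarrow> F (r + N * k) = 0"
proof -
  \<comment> \<open>A prime exceeding the absolute value of the nonzero integer
    \<open>det M * c\<close> cannot divide it.\<close>
  obtain p where p: "prime p" "p > nat \<bar>det M * c\<bar>"
    using bigger_prime by blast
  have nd: "\<not> int p dvd det M * c"
  proof
    assume "int p dvd det M * c"
    then have "int p \<le> \<bar>det M * c\<bar>"
      using det c by (intro zdvd_imp_le) auto
    then show False using p by linarith
  qed
  have cop: "coprime (int p ^ 2) (det M)" "coprime (int p ^ 2) c"
    using p nd by (auto intro!: prime_imp_coprime)
  let ?q = "int p ^ 2"
  have q: "?q > 0" "?q \<noteq> 0" using prime_gt_0_nat[OF p(1)] by auto
  obtain N B where N: "N > 0" "B \<in> carrier_mat n n" "M ^\<^sub>m N = 1\<^sub>m n + ?q \<cdot>\<^sub>m B" "?q dvd c ^ N - 1"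
    by (rule mat_power_cong_one[OF M q(1) cop])
  show ?thesis
  proof (intro that[of N] allI impI)
    fix r k
    assume inf: "infinite {k. F (r + N * k) = 0}"
    have nc: "newton_small ?q (\<lambda>k. c ^ (r + N * k))"
      using newton_small_geometric[OF N(4), of "c ^ r"] by (simp add: power_add power_mult)
    have "newton_small ?q (\<lambda>k. det (M ^\<^sub>m (r + N * k) - c ^ (r + N * k) \<cdot>\<^sub>m 1\<^sub>m n))"
    proof (rule newton_small_det[OF q(2)])
      fix i j assume ij: "i < n" "j < n"
      have "newton_small ?q (\<lambda>k. ((M ^\<^sub>m N) ^\<^sub>m k * M ^\<^sub>m r) $$ (i,j))"
        using M N ij by (intro newton_small_mat_power) auto
      then have "newton_small ?q (\<lambda>k. (M ^\<^sub>m (r + N * k)) $$ (i,j))"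
        by (simp add: pow_mat_mult[OF M, symmetric] pow_mat_add[OF M, symmetric] add.commute)
      then have "newton_small ?q (\<lambda>k. (M ^\<^sub>m (r + N * k)) $$ (i,j) - c ^ (r + N * k) * 1\<^sub>m n $$ (i,j))"
        using nc q by (intro newton_small_diff newton_small_mult newton_small_const) auto
      then show "newton_small ?q (\<lambda>k. (M ^\<^sub>m (r + N * k) - c ^ (r + N * k) \<cdot>\<^sub>m 1\<^sub>m n) $$ (i,j))"
        using M ij by simp
    qed (auto intro: minus_carrier_mat)
    then have "newton_small ?q (\<lambda>k. F (r + N * k))"
      unfolding F_def using nc q
      by (intro newton_small_diff newton_small_mult newton_small_power) auto
    then show "F (r + N * k) = 0"
      using inf by (rule newton_small_infinite_zeros[OF p(1)])
  qed (rule N(1))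
qed

section \<open>The norm from \<open>\<int>[X]/(X\<^sup>n - 1)\<close>\<close>

text \<open>The columns of the Vandermonde matrix \<open>V\<close> are eigenvectors of
  \<open>A\<close> with eigenvalues \<open>h j\<close>, so \<open>A * V = V * D\<close> with
  \<open>D\<close> diagonal, and \<open>det V\<close> cancels.\<close>

lemma det_eq_prod_if_vandermonde:
  fixes A :: "'a :: idom mat"
  assumes A: "A \<in> carrier_mat n n" and inj: "inj_on z {..<n}"
    and eq: "\<And>i j. i < n \<Longrightarrow> j < n \<Longrightarrow> (\<Sum>k<n. A $$ (i,k) * z j ^ k) = z j ^ i * h j"
  shows "det A = (\<Prod>j<n. h j)"
proof -
  define V where "V = mat n n (\<lambda>(i,j). z j ^ i)"
  define D where "D = mat n n (\<lambda>(i,j). if i = j then h j else 0)"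
  have V: "V \<in> carrier_mat n n" and D: "D \<in> carrier_mat n n" by (simp_all add: V_def D_def)
  have "det V \<noteq> 0"
  proof
    assume "det V = 0"
    then have "det V\<^sup>T = 0" using det_transpose[OF V] by simp
    then obtain v where v: "v \<in> carrier_vec n" "v \<noteq> 0\<^sub>v n" "V\<^sup>T *\<^sub>v v = 0\<^sub>v n"
      using det_0_iff_vec_prod_zero[of "V\<^sup>T" n] V by auto
    \<comment> \<open>A kernel vector of the transpose is the coefficient vector of a polynomial of
      degree below \<open>n\<close> vanishing at all \<open>n\<close> points.\<close>
    define p where "p = (\<Sum>i<n. monom (v $ i) i)"
    have c: "coeff p i = (if i < n then v $ i else 0)" for i
      by (auto simp: p_def coeff_sum)
    have "p = 0"
    proof (rule poly_eq_0_if_many_roots)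
      show "finite (z ` {..<n})" by simp
      fix x assume "x \<in> z ` {..<n}"
      then obtain j where j: "x = z j" "j < n" by auto
      have "poly p x = (\<Sum>i<n. v $ i * z j ^ i)"
        by (simp add: p_def poly_sum poly_monom j)
      also have "\<dots> = (V\<^sup>T *\<^sub>v v) $ j"
        using j v(1) by (auto simp: V_def scalar_prod_def atLeast0LessThan mult.commute intro!: sum.cong)
      finally show "poly p x = 0" using v j by simp
    next
      fix i assume "card (z ` {..<n}) \<le> i"
      then show "coeff p i = 0" using c inj by (simp add: card_image)
    qed
    then have "v $ i = 0" if "i < n" for i
      using c[of i] that by simp
    then have "v = 0\<^sub>v n" using v(1) by (intro eq_vecI) auto
    with v show False by simp
  qed
  moreover have "A * V = V * D"
  proof (rule eq_matI)
    fix i j assume "i < dim_row (V * D)" "j < dim_col (V * D)"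
    then have ij: "i < n" "j < n" by (auto simp: V_def D_def)
    have "(A * V) $$ (i,j) = (\<Sum>k<n. A $$ (i,k) * z j ^ k)"
      using A ij by (auto simp: V_def scalar_prod_def atLeast0LessThan intro!: sum.cong)
    also have "\<dots> = z j ^ i * h j" by (rule eq[OF ij])
    also have "\<dots> = (\<Sum>k<n. z k ^ i * (if k = j then h j else 0))"
      using ij by (simp add: if_distrib[of "(*) _"] cong: if_cong)
    also have "\<dots> = (V * D) $$ (i,j)"
      using ij by (simp add: V_def D_def scalar_prod_def atLeast0LessThan)
    finally show "(A * V) $$ (i,j) = (V * D) $$ (i,j)" .
  qed (use A in \<open>auto simp: V_def D_def\<close>)
  then have "det A * det V = det V * det D"
    using det_mult[OF A V] det_mult[OF V D] by metis
  ultimately have "det A = det D" by simp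
  also have "\<dots> = (\<Prod>j<n. h j)"
    by (subst det_upper_triangular[OF _ D])
      (auto simp: D_def prod_list_diag_prod atLeast0LessThan upper_triangular_def)
  finally show ?thesis .
qed

text \<open>For \<open>n = 0\<close> the index set is infinite and the product defaults to 1, so the
  condition of having square 1 is meaningful only together with \<open>n > 0\<close>.\<close>

definition cyc_norm :: "nat \<Rightarrow> int poly \<Rightarrow> complex" where
  "cyc_norm n f = (\<Prod>z\<in>{z. z ^ n = 1}. poly (of_int_poly f) z)"

lemma cyc_norm_mult: "cyc_norm n (f * g) = cyc_norm n f * cyc_norm n g"
  by (simp add: cyc_norm_def prod.distrib of_int_poly_hom.hom_mult)

lemma degree_monom_minus_one: "n > 0 \<Longrightarrow> degree (monom 1 n - 1 :: int poly) = n"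
  using degree_add_eq_left[of "- 1" "monom (1::int) n"] by (simp add: degree_monom_eq)

lemma poly_of_int_poly_root_of_unity:
  fixes z :: complex
  assumes "z ^ n = 1"
  shows "poly (of_int_poly ((monom 1 n - 1) * u + v)) z = poly (of_int_poly v) z"
proof -
  have "poly (of_int_poly (monom 1 n - 1)) z = 0"
    using assms by (simp add: hom_distribs poly_monom)
  then show ?thesis by (simp only: of_int_poly_hom.hom_mult of_int_poly_hom.hom_add poly_add poly_mult) simp
qed

text \<open>The matrix of multiplication by \<open>f\<close> in the basis \<open>1, X, \<dots>\<close> of \<open>\<int>[X]/(X\<^sup>n - 1)\<close>.\<close>

lemma circulant_mat:
  fixes f :: "int poly"
  assumes n: "n > 0"
  obtains A q where "A \<in> carrier_mat n n" "of_int (det A) = cyc_norm n f"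
    "\<forall>i<n. monom 1 i * f = (monom 1 n - 1) * q i + (\<Sum>j<n. monom (A $$ (i,j)) j)"
proof -
  let ?m = "monom 1 n - 1 :: int poly"
  have lead: "lead_coeff ?m = 1"
    using n by (simp add: degree_monom_minus_one)
  have "\<exists>q r. p = ?m * q + r \<and> (\<forall>i\<ge>n. coeff r i = 0)" for p
    using monic_divmod[OF lead, of p] unfolding degree_monom_minus_one[OF n] by blast
  then obtain q r where qr: "\<And>p. p = ?m * q p + r p" "\<And>p i. i \<ge> n \<Longrightarrow> coeff (r p) i = 0"
    by metis
  define A where "A = mat n n (\<lambda>(i,j). coeff (r (monom 1 i * f)) j)"
  have A: "A \<in> carrier_mat n n" by (simp add: A_def)
  have row: "monom 1 i * f = ?m * q (monom 1 i * f) + (\<Sum>j<n. monom (A $$ (i,j)) j)" if "i < n" for i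
  proof -
    have "r (monom 1 i * f) = (\<Sum>j<n. monom (A $$ (i,j)) j)"
      by (rule poly_eqI) (use that in \<open>auto simp: coeff_sum A_def qr(2)\<close>)
    then show ?thesis using qr(1)[of "monom 1 i * f"] by simp
  qed
  define Q where "Q i = q (monom 1 i * f)" for i
  note row = row[folded Q_def]
  obtain z :: "nat \<Rightarrow> complex" where z: "bij_betw z {..<n} {z. z ^ n = 1}"
    using bij_betw_roots_unity[OF n] by blast
  \<comment> \<open>Read at a root of unity \<open>z j\<close>, the row relations say that the
    powers of \<open>z j\<close> form an eigenvector with eigenvalue \<open>f(z j)\<close>.\<close>
  have "det (map_mat of_int A) = (\<Prod>j<n. poly (of_int_poly f) (z j))"
  proof (rule det_eq_prod_if_vandermonde)
    show "inj_on z {..<n}" using z by (simp add: bij_betw_def)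
    fix i j assume ij: "i < n" "j < n"
    have "z j ^ n = 1" using z ij by (auto simp: bij_betw_def)
    have "poly (of_int_poly (monom 1 i * f)) (z j) = z j ^ i * poly (of_int_poly f) (z j)"
      by (simp add: of_int_poly_hom.hom_mult poly_monom)
    moreover have "poly (of_int_poly (monom 1 i * f)) (z j) =
        poly (of_int_poly (\<Sum>k<n. monom (A $$ (i,k)) k)) (z j)"
      using poly_of_int_poly_root_of_unity[OF \<open>z j ^ n = 1\<close>] by (simp only: row[OF ij(1)])
    moreover have "\<dots> = (\<Sum>k<n. map_mat of_int A $$ (i,k) * z j ^ k)"
      unfolding of_int_poly_hom.hom_sum poly_sum
      by (intro sum.cong refl) (use ij A in \<open>simp add: poly_monom\<close>)
    ultimately show "(\<Sum>k<n. map_mat of_int A $$ (i,k) * z j ^ k) = z j ^ i * poly (of_int_poly f) (z j)"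
      by simp
  qed (use A in simp)
  also have "\<dots> = cyc_norm n f"
    unfolding cyc_norm_def by (rule prod.reindex_bij_betw[OF z])
  finally show ?thesis
    using A row by (intro that[of A Q]) auto
qed

text \<open>Forward, the norm is multiplicative with integer values, and two integers with product 1
  have square 1. Backward, the multiplication matrix has determinant 1 or -1, hence an integral
  inverse.\<close>

lemma unit_iff_cyc_norm:
  fixes f :: "int poly"
  assumes n: "n > 0"
  shows "(\<exists>g. (monom 1 n - 1) dvd (f * g - 1)) \<longleftrightarrow> (cyc_norm n f)\<^sup>2 = 1"
proof
  assume "\<exists>g. (monom 1 n - 1) dvd (f * g - 1)"
  then obtain g u where "f * g - 1 = (monom 1 n - 1) * u" by (auto elim: dvdE)
  then have fg: "f * g = (monom 1 n - 1) * u + 1" by (simp add: algebra_simps)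
  obtain a b :: int where ab: "of_int a = cyc_norm n f" "of_int b = cyc_norm n g"
    using circulant_mat[OF n] by metis
  have "cyc_norm n (f * g) = 1"
    unfolding cyc_norm_def
  proof (intro prod.neutral ballI)
    fix z :: complex assume "z \<in> {z. z ^ n = 1}"
    then show "poly (of_int_poly (f * g)) z = 1"
      unfolding fg by (subst poly_of_int_poly_root_of_unity) simp_all
  qed
  then have "(of_int (a * b) :: complex) = of_int 1"
    by (simp add: cyc_norm_mult ab)
  then have "a * b = 1" by (simp only: of_int_eq_iff)
  then have "a\<^sup>2 = 1" using zmult_eq_1_iff by auto
  then show "(cyc_norm n f)\<^sup>2 = 1" by (metis ab(1) of_int_1 of_int_power)
next
  assume N: "(cyc_norm n f)\<^sup>2 = 1"
  obtain A q where A: "A \<in> carrier_mat n n" "of_int (det A) = cyc_norm n f"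
    and row: "\<forall>i<n. monom 1 i * f = (monom 1 n - 1) * q i + (\<Sum>j<n. monom (A $$ (i,j)) j)"
    by (rule circulant_mat[OF n, of f])
  have "(of_int ((det A)\<^sup>2) :: complex) = of_int 1"
    using N A by simp
  then have det: "det A * det A = 1"
    by (simp only: of_int_eq_iff power2_eq_square)
  define B where "B = det A \<cdot>\<^sub>m adj_mat A"
  have B: "B \<in> carrier_mat n n" using adj_mat(1)[OF A(1)] by (simp add: B_def)
  have "B * A = det A \<cdot>\<^sub>m (det A \<cdot>\<^sub>m 1\<^sub>m n)"
    unfolding B_def using adj_mat(1,3)[OF A(1)] A by (simp add: mult_smult_assoc_mat[of _ n n _ n])
  also have "\<dots> = 1\<^sub>m n"
    by (rule eq_matI) (simp_all add: det)
  finally have BA: "B * A = 1\<^sub>m n" .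
  \<comment> \<open>Row 0 of the inverse expresses the class of 1 as a combination of the classes of
    \<open>X^i f\<close>; its entries are the coefficients of the sought inverse
    \<open>g\<close>.\<close>
  define b where "b i = [:B $$ (0,i):]" for i
  define g where "g = (\<Sum>i<n. b i * monom 1 i)"
  have "f * g = (\<Sum>i<n. b i * (monom 1 i * f))"
    by (simp add: g_def sum_distrib_left ac_simps)
  also have "\<dots> = (\<Sum>i<n. (monom 1 n - 1) * (b i * q i) + (\<Sum>j<n. b i * monom (A $$ (i,j)) j))"
  proof (intro sum.cong refl)
    fix i assume "i \<in> {..<n}"
    then have "b i * (monom 1 i * f) = b i * ((monom 1 n - 1) * q i + (\<Sum>j<n. monom (A $$ (i,j)) j))"
      by (intro arg_cong[of _ _ "(*) (b i)"] row[rule_format]) simp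
    then show "b i * (monom 1 i * f) = (monom 1 n - 1) * (b i * q i) + (\<Sum>j<n. b i * monom (A $$ (i,j)) j)"
      by (simp only: distrib_left sum_distrib_left mult.left_commute[of "b i"])
  qed
  also have "\<dots> = (monom 1 n - 1) * (\<Sum>i<n. b i * q i) + (\<Sum>i<n. \<Sum>j<n. b i * monom (A $$ (i,j)) j)"
    by (subst sum.distrib, subst sum_distrib_left) (rule refl)
  also have "(\<Sum>i<n. \<Sum>j<n. b i * monom (A $$ (i,j)) j) = 1"
  proof (rule poly_eqI)
    fix k
    have "coeff (\<Sum>i<n. \<Sum>j<n. b i * monom (A $$ (i,j)) j) k =
        (if k < n then \<Sum>i<n. B $$ (0,i) * A $$ (i,k) else 0)"
      by (auto simp: b_def coeff_sum smult_monom if_distrib[of "(*) _"] cong: if_cong)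
    also have "\<dots> = (if k < n then (B * A) $$ (0,k) else 0)"
      using A B n by (auto simp: scalar_prod_def atLeast0LessThan)
    also have "\<dots> = coeff 1 k"
      using n by (auto simp: BA)
    finally show "coeff (\<Sum>i<n. \<Sum>j<n. b i * monom (A $$ (i,j)) j) k = coeff 1 k" .
  qed
  finally have "f * g - 1 = (monom 1 n - 1) * (\<Sum>i<n. b i * q i)" by simp
  then show "\<exists>g. (monom 1 n - 1) dvd (f * g - 1)" by (metis dvd_triv_left)
qed

section \<open>The norm as a determinant of fixed size\<close>

text \<open>With this orientation the vector of powers of a root of a monic \<open>g\<close> is an
  eigenvector.\<close>

definition companion_mat :: "'a :: comm_ring_1 poly \<Rightarrow> 'a mat" where
  "companion_mat g = mat (degree g) (degree g)
    (\<lambda>(i,j). if Suc i = degree g then - coeff g j else if j = Suc i then 1 else 0)"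

lemma companion_mat_carrier [simp]: "companion_mat g \<in> carrier_mat (degree g) (degree g)"
  by (simp add: companion_mat_def)

lemma map_mat_companion_mat: "map_mat of_int (companion_mat g) = (companion_mat (of_int_poly g) :: complex mat)"
  by (rule eq_matI) (auto simp: companion_mat_def)

text \<open>Cramer's rule for the vector of powers of \<open>x\<close>, which the matrix maps to a multiple of the
  last basis vector.\<close>

lemma det_companion_mat:
  fixes g :: "'a :: idom poly"
  assumes monic: "lead_coeff g = 1"
  shows "det (x \<cdot>\<^sub>m 1\<^sub>m (degree g) - companion_mat g) = poly g x"
proof (cases "degree g")
  case 0
  have "x \<cdot>\<^sub>m 1\<^sub>m (degree g) - companion_mat g \<in> carrier_mat 0 0"
    by (rule minus_carrier_mat) (metis 0 companion_mat_carrier)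
  with 0 show ?thesis
    using monic by (simp add: poly_altdef det_dim_zero)
next
  case (Suc d)
  define A where "A = x \<cdot>\<^sub>m 1\<^sub>m (Suc d) - companion_mat g"
  have A: "A \<in> carrier_mat (Suc d) (Suc d)"
    unfolding A_def by (rule minus_carrier_mat) (metis Suc companion_mat_carrier)
  have ent: "A $$ (i,j) = (if i = j then x else 0) -
      (if i = d then - coeff g j else if j = Suc i then 1 else 0)" if "i < Suc d" "j < Suc d" for i j
    using that by (simp add: A_def companion_mat_def Suc)
  define v where "v = vec (Suc d) (\<lambda>i. x ^ i)"
  define b where "b = vec (Suc d) (\<lambda>i. if i = d then poly g x else 0)"
  have v: "v \<in> carrier_vec (Suc d)" by (simp add: v_def)
  have "A *\<^sub>v v = b"
  proof (rule eq_vecI)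
    fix i assume "i < dim_vec b"
    then have i: "i < Suc d" by (simp add: b_def)
    have "(A *\<^sub>v v) $ i = (\<Sum>j<Suc d. A $$ (i,j) * x ^ j)"
      using A i by (auto simp: v_def scalar_prod_def atLeast0LessThan intro!: sum.cong)
    also have "\<dots> = (\<Sum>j<Suc d. (if i = j then x * x ^ j else 0) -
        (if i = d then - coeff g j * x ^ j else if j = Suc i then x ^ j else 0))"
      by (intro sum.cong) (use i ent in \<open>auto simp: left_diff_distrib simp del: minus_mult_left\<close>)
    also have "\<dots> = x ^ Suc i - (\<Sum>j<Suc d. if i = d then - coeff g j * x ^ j else if j = Suc i then x ^ j else 0)"
      using i by (simp add: sum_subtractf del: sum.lessThan_Suc)
    also have "\<dots> = b $ i"
    proof (cases "i = d")
      case True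
      have "poly g x = (\<Sum>j<Suc d. coeff g j * x ^ j) + x ^ Suc d"
        unfolding poly_altdef Suc using monic Suc by (simp add: lessThan_Suc_atMost[symmetric])
      then show ?thesis
        using True by (simp add: b_def sum_negf del: sum.lessThan_Suc)
    next
      case False
      then show ?thesis using i by (simp add: b_def del: sum.lessThan_Suc)
    qed
    finally show "(A *\<^sub>v v) $ i = b $ i" .
  qed (use A in \<open>simp add: b_def\<close>)
  \<comment> \<open>Column 0 is chosen because the entry of \<open>v\<close> there is
    \<open>x ^ 0 = 1\<close>.\<close>
  then have "det A = det (replace_col A b 0)"
    using cramer_lemma_mat[OF A v, of 0] by (simp add: v_def)
  also have "\<dots> = (\<Sum>i<Suc d. replace_col A b 0 $$ (i,0) * cofactor (replace_col A b 0) i 0)"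
    by (rule laplace_expansion_column) (use A in \<open>auto simp: replace_col_def\<close>)
  also have "\<dots> = (\<Sum>i<Suc d. if i = d then poly g x * cofactor (replace_col A b 0) i 0 else 0)"
    by (intro sum.cong) (use A in \<open>auto simp: replace_col_def b_def\<close>)
  also have "\<dots> = poly g x * cofactor (replace_col A b 0) d 0"
    by simp
  also have "cofactor (replace_col A b 0) d 0 = (- 1) ^ d * det (mat_delete (replace_col A b 0) d 0)"
    by (simp add: cofactor_def)
  \<comment> \<open>Without the last row and column 0, the superdiagonal of \<open>A\<close> becomes
    the diagonal, with entries -1; the two signs \<open>(- 1) ^ d\<close> cancel.\<close>
  also have "det (mat_delete (replace_col A b 0) d 0) = prod_list (diag_mat (mat_delete (replace_col A b 0) d 0))"
  proof (rule det_lower_triangular[of d])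
    fix i j assume "i < j" "j < d"
    then show "mat_delete (replace_col A b 0) d 0 $$ (i,j) = 0"
      using A by (simp add: mat_delete_def replace_col_def ent)
  qed (use A in \<open>auto simp: mat_delete_def replace_col_def\<close>)
  also have "\<dots> = (\<Prod>i<d. - 1)"
    unfolding prod_list_diag_prod using A
    by (intro prod.cong) (auto simp: mat_delete_def replace_col_def ent)
  finally show ?thesis
    by (simp add: A_def Suc power_mult_distrib[symmetric])
qed

section \<open>Polynomials evaluated at a matrix\<close>

definition mat_eval :: "'a :: comm_ring_1 mat \<Rightarrow> 'a poly \<Rightarrow> 'a mat" where
  "mat_eval A p = mat (dim_row A) (dim_row A) (\<lambda>ij. \<Sum>k\<le>degree p. coeff p k * (A ^\<^sub>m k) $$ ij)"

lemma mat_eval_index: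
  assumes A: "A \<in> carrier_mat d d" and "degree p \<le> N" "i < d" "j < d"
  shows "mat_eval A p $$ (i,j) = (\<Sum>k\<le>N. coeff p k * (A ^\<^sub>m k) $$ (i,j))"
proof -
  have "(\<Sum>k\<le>degree p. coeff p k * (A ^\<^sub>m k) $$ (i,j)) = (\<Sum>k\<le>N. coeff p k * (A ^\<^sub>m k) $$ (i,j))"
    by (rule sum.mono_neutral_left) (use assms in \<open>auto simp: coeff_eq_0\<close>)
  then show ?thesis using assms by (simp add: mat_eval_def)
qed

lemma mat_eval_carrier: "A \<in> carrier_mat d d \<Longrightarrow> mat_eval A p \<in> carrier_mat d d"
  by (simp add: mat_eval_def)

text \<open>Multiplication by \<open>X\<close> shifts the powers of \<open>A\<close>. Linear factors
  suffice, since the polynomial to be evaluated splits over the complex numbers.\<close>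

lemma mat_eval_linear_mult:
  fixes A :: "'a :: comm_ring_1 mat"
  assumes A: "A \<in> carrier_mat d d"
  shows "mat_eval A ([:- s, 1:] * p) = (A - s \<cdot>\<^sub>m 1\<^sub>m d) * mat_eval A p"
proof (rule eq_matI)
  fix i j assume "i < dim_row ((A - s \<cdot>\<^sub>m 1\<^sub>m d) * mat_eval A p)"
    "j < dim_col ((A - s \<cdot>\<^sub>m 1\<^sub>m d) * mat_eval A p)"
  then have ij: "i < d" "j < d" using A by (auto simp: mat_eval_def)
  let ?N = "degree p"
  have pow: "(A ^\<^sub>m Suc k) $$ (i,j) = (\<Sum>l<d. A $$ (i,l) * (A ^\<^sub>m k) $$ (l,j))" for k
    using A ij pow_mat_add[OF A, of 1 k] by (simp add: scalar_prod_def atLeast0LessThan)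
  have "mat_eval A ([:- s, 1:] * p) $$ (i,j) =
      (\<Sum>k\<le>Suc ?N. coeff ([:- s, 1:] * p) k * (A ^\<^sub>m k) $$ (i,j))"
    by (rule mat_eval_index[OF A])
      (use ij degree_mult_le[of "[:- s, 1:]" p] in \<open>auto intro: le_trans\<close>)
  also have "\<dots> = (\<Sum>k\<le>Suc ?N. coeff (pCons 0 p) k * (A ^\<^sub>m k) $$ (i,j)) -
      s * (\<Sum>k\<le>Suc ?N. coeff p k * (A ^\<^sub>m k) $$ (i,j))"
    by (simp add: sum_distrib_left sum_subtractf[symmetric] algebra_simps del: sum.atMost_Suc pow_mat.simps)
  also have "(\<Sum>k\<le>Suc ?N. coeff (pCons 0 p) k * (A ^\<^sub>m k) $$ (i,j)) =
      (\<Sum>k\<le>?N. coeff p k * (A ^\<^sub>m Suc k) $$ (i,j))"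
    by (subst sum.atMost_Suc_shift) (simp del: pow_mat.simps)
  also have "\<dots> = (\<Sum>l<d. A $$ (i,l) * mat_eval A p $$ (l,j))"
    unfolding pow using ij
    by (simp add: mat_eval_index[OF A order_refl] sum_distrib_left mult.left_commute)
      (rule sum.swap)
  also have "(\<Sum>k\<le>Suc ?N. coeff p k * (A ^\<^sub>m k) $$ (i,j)) = mat_eval A p $$ (i,j)"
    by (rule mat_eval_index[OF A, symmetric]) (use ij in auto)
  also have "s * mat_eval A p $$ (i,j) = (\<Sum>l<d. if l = i then s * mat_eval A p $$ (l,j) else 0)"
    using ij by simp
  also have "(\<Sum>l<d. A $$ (i,l) * mat_eval A p $$ (l,j)) - \<dots> =
      (\<Sum>l<d. (A - s \<cdot>\<^sub>m 1\<^sub>m d) $$ (i,l) * mat_eval A p $$ (l,j))"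
    unfolding sum_subtractf[symmetric]
    using ij A by (intro sum.cong) (auto simp: algebra_simps)
  also have "\<dots> = ((A - s \<cdot>\<^sub>m 1\<^sub>m d) * mat_eval A p) $$ (i,j)"
    using ij A mat_eval_carrier[OF A, of p] by (simp add: scalar_prod_def atLeast0LessThan)
  finally show "mat_eval A ([:- s, 1:] * p) $$ (i,j) = ((A - s \<cdot>\<^sub>m 1\<^sub>m d) * mat_eval A p) $$ (i,j)" .
qed (use A in \<open>auto simp: mat_eval_def\<close>)

lemma det_mat_eval_prod:
  fixes A :: "'a :: comm_ring_1 mat"
  assumes A: "A \<in> carrier_mat d d" and "finite S"
  shows "det (mat_eval A (\<Prod>s\<in>S. [:- s, 1:])) = (\<Prod>s\<in>S. det (A - s \<cdot>\<^sub>m 1\<^sub>m d))"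
  using assms(2)
proof (induction S rule: finite_induct)
  case empty
  have "mat_eval A 1 = 1\<^sub>m d"
    by (rule eq_matI) (use A in \<open>auto simp: mat_eval_def\<close>)
  then show ?case by simp
next
  case (insert s S)
  have "A - s \<cdot>\<^sub>m 1\<^sub>m d \<in> carrier_mat d d" by (rule minus_carrier_mat) simp
  then show ?case
    using insert by (simp add: mat_eval_linear_mult[OF A] det_mult mat_eval_carrier[OF A] del: mult_pCons_left)
qed

text \<open>Both sides are monic of degree \<open>n\<close> and vanish at the \<open>n\<close>
  distinct numbers \<open>c * z\<close>, so their difference has degree below \<open>n\<close> and
  too many roots.\<close>

lemma prod_roots_of_unity_scaled:
  fixes c :: complex
  assumes n: "n > 0" and c: "c \<noteq> 0"
  shows "(\<Prod>s\<in>(*) c ` {z. z ^ n = 1}. [:- s, 1:]) = monom 1 n - [:c ^ n:]"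
proof -
  let ?S = "(*) c ` {z. z ^ n = 1}"
  let ?P = "\<Prod>s\<in>?S. [:- s, 1:]"
  have S: "finite ?S" "card ?S = n"
    using n c by (auto simp: finite_roots_unity card_image inj_on_def card_roots_unity_eq)
  have deg: "degree ?P = n"
    using S by (subst degree_prod_eq_sum_degree) auto
  moreover have "lead_coeff ?P = 1" by (simp add: lead_coeff_prod)
  ultimately have top: "coeff ?P n = 1" by simp
  have "?P - (monom 1 n - [:c ^ n:]) = 0"
  proof (rule poly_eq_0_if_many_roots[OF S(1)])
    fix s assume s: "s \<in> ?S"
    then have "poly ?P s = 0" using S by (auto simp: poly_prod)
    moreover have "s ^ n = c ^ n" using s by (auto simp: power_mult_distrib)
    ultimately show "poly (?P - (monom 1 n - [:c ^ n:])) s = 0"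
      by (simp add: poly_monom)
  next
    fix i assume "card ?S \<le> i"
    then have "i \<ge> n" by (simp add: S)
    then show "coeff (?P - (monom 1 n - [:c ^ n:])) i = 0"
      using top deg n by (cases "i = n") (auto simp: coeff_eq_0 coeff_pCons split: nat.split)
  qed
  then show ?thesis by simp
qed

lemma det_power_diff_scalar:
  fixes A :: "complex mat"
  assumes A: "A \<in> carrier_mat d d" and n: "n > 0" and c: "c \<noteq> 0"
  shows "det (A ^\<^sub>m n - c ^ n \<cdot>\<^sub>m 1\<^sub>m d) = (\<Prod>z\<in>{z. z ^ n = 1}. det (A - (c * z) \<cdot>\<^sub>m 1\<^sub>m d))"
proof -
  let ?p = "monom 1 n - [:c ^ n:]"
  have deg: "degree ?p \<le> n"
    by (intro degree_diff_le) (auto simp: degree_monom_eq)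
  have "mat_eval A ?p = A ^\<^sub>m n - c ^ n \<cdot>\<^sub>m 1\<^sub>m d"
  proof (rule eq_matI)
    fix i j assume "i < dim_row (A ^\<^sub>m n - c ^ n \<cdot>\<^sub>m 1\<^sub>m d)" "j < dim_col (A ^\<^sub>m n - c ^ n \<cdot>\<^sub>m 1\<^sub>m d)"
    then have ij: "i < d" "j < d" using A by auto
    have "mat_eval A ?p $$ (i,j) = (\<Sum>k\<le>n. coeff ?p k * (A ^\<^sub>m k) $$ (i,j))"
      by (rule mat_eval_index[OF A deg ij])
    also have "\<dots> = (\<Sum>k\<le>n. (if k = n then (A ^\<^sub>m k) $$ (i,j) else 0) - (if k = 0 then c ^ n * (A ^\<^sub>m k) $$ (i,j) else 0))"
      by (intro sum.cong) (auto simp: coeff_pCons algebra_simps split: nat.split)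
    also have "\<dots> = (A ^\<^sub>m n - c ^ n \<cdot>\<^sub>m 1\<^sub>m d) $$ (i,j)"
      using ij A by (simp add: sum_subtractf)
    finally show "mat_eval A ?p $$ (i,j) = (A ^\<^sub>m n - c ^ n \<cdot>\<^sub>m 1\<^sub>m d) $$ (i,j)" .
  qed (use A in \<open>auto simp: mat_eval_def\<close>)
  then have "det (A ^\<^sub>m n - c ^ n \<cdot>\<^sub>m 1\<^sub>m d) = (\<Prod>s\<in>(*) c ` {z. z ^ n = 1}. det (A - s \<cdot>\<^sub>m 1\<^sub>m d))"
    using det_mat_eval_prod[OF A, of "(*) c ` {z. z ^ n = 1}"] n
    by (simp add: prod_roots_of_unity_scaled[OF n c] finite_roots_unity)
  also have "\<dots> = (\<Prod>z\<in>{z. z ^ n = 1}. det (A - (c * z) \<cdot>\<^sub>m 1\<^sub>m d))"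
    using c by (subst prod.reindex) (auto simp: inj_on_def)
  finally show ?thesis .
qed

text \<open>For \<open>f\<close> of degree \<open>d\<close> with leading coefficient \<open>c\<close> this is the monic polynomial
  \<open>c\<^sup>d\<^sup>-\<^sup>1 f(X / c)\<close>.\<close>

definition monic_scaled :: "int poly \<Rightarrow> int poly" where
  "monic_scaled f = monom 1 (degree f) + (\<Sum>i<degree f. monom (lead_coeff f ^ (degree f - 1 - i) * coeff f i) i)"

lemma coeff_monic_scaled:
  "coeff (monic_scaled f) i = (if i < degree f then lead_coeff f ^ (degree f - 1 - i) * coeff f i
    else if i = degree f then 1 else 0)"
  by (auto simp: monic_scaled_def coeff_sum)

lemma degree_monic_scaled [simp]: "degree (monic_scaled f) = degree f"
  by (rule antisym[OF degree_le le_degree]) (auto simp: coeff_monic_scaled)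

text \<open>The extra factor \<open>lead_coeff f\<close> on the left keeps the identity valid for
  constant \<open>f\<close>, where \<open>degree f - 1\<close> is truncated to 0.\<close>

lemma poly_monic_scaled:
  "of_int (lead_coeff f) * poly (of_int_poly (monic_scaled f)) (of_int (lead_coeff f) * z) =
    of_int (lead_coeff f) ^ degree f * poly (of_int_poly f) (z :: complex)"
proof -
  let ?c = "of_int (lead_coeff f) :: complex"
  have "?c * poly (of_int_poly (monic_scaled f)) (?c * z) =
      (\<Sum>i\<le>degree f. ?c * (of_int (coeff (monic_scaled f) i) * (?c * z) ^ i))"
    by (simp add: poly_altdef sum_distrib_left)
  also have "\<dots> = (\<Sum>i\<le>degree f. ?c ^ degree f * (of_int (coeff f i) * z ^ i))"
  proof (intro sum.cong refl)
    fix i assume "i \<in> {..degree f}"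
    then consider "i < degree f" | "i = degree f" by fastforce
    then show "?c * (of_int (coeff (monic_scaled f) i) * (?c * z) ^ i) = ?c ^ degree f * (of_int (coeff f i) * z ^ i)"
    proof cases
      case 1
      then have "?c ^ degree f = ?c * ?c ^ (degree f - 1 - i) * ?c ^ i"
        by (simp add: power_add[symmetric] power_Suc[symmetric] del: power_Suc)
      then show ?thesis
        using 1 by (simp add: coeff_monic_scaled power_mult_distrib)
    qed (simp add: coeff_monic_scaled power_mult_distrib)
  qed
  also have "\<dots> = ?c ^ degree f * poly (of_int_poly f) z"
    by (simp add: poly_altdef sum_distrib_left)
  finally show ?thesis .
qed

text \<open>Up to sign the determinant is the characteristic polynomial at 0, which is a power of
  the leading coefficient times \<open>coeff f 0\<close>, or 1 for constant
  \<open>f\<close>.\<close>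

lemma det_companion_mat_monic_scaled:
  assumes "coeff f 0 \<noteq> 0"
  shows "det (companion_mat (monic_scaled f)) \<noteq> 0"
proof -
  let ?M = "companion_mat (monic_scaled f)"
  have M: "?M \<in> carrier_mat (degree f) (degree f)"
    using companion_mat_carrier[of "monic_scaled f"] by simp
  have "0 \<cdot>\<^sub>m 1\<^sub>m (degree f) - ?M = (- 1) \<cdot>\<^sub>m ?M"
    by (rule eq_matI) (use M in auto)
  then have "det ((- 1) \<cdot>\<^sub>m ?M) = coeff (monic_scaled f) 0"
    using det_companion_mat[of "monic_scaled f" 0] by (simp add: poly_0_coeff_0 coeff_monic_scaled)
  also have "\<dots> \<noteq> 0"
    using assms by (auto simp: coeff_monic_scaled)
  finally show ?thesis by auto
qed

text \<open>The determinant splits into the values of the characteristic polynomial at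
  \<open>c * z\<close> over the roots of unity \<open>z\<close>, up to sign. Squaring removes the
  signs, and \<open>c ^ n\<close> supplies one factor \<open>c\<close> per root for
  \<open>poly_monic_scaled\<close>.\<close>

lemma cyc_norm_eq_det:
  fixes f :: "int poly"
  assumes f: "f \<noteq> 0" and n: "n > 0"
  defines "c \<equiv> lead_coeff f" and "d \<equiv> degree f" and "M \<equiv> companion_mat (monic_scaled f)"
  shows "(cyc_norm n f)\<^sup>2 = 1 \<longleftrightarrow> (det (M ^\<^sub>m n - c ^ n \<cdot>\<^sub>m 1\<^sub>m d))\<^sup>2 * (c ^ n) ^ 2 - (c ^ n) ^ (2 * d) = 0"
proof -
  let ?c = "of_int c :: complex" and ?g = "monic_scaled f" and ?Z = "{z::complex. z ^ n = 1}"
  let ?D = "det (M ^\<^sub>m n - c ^ n \<cdot>\<^sub>m 1\<^sub>m d)"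
  define A where "A = companion_mat (of_int_poly ?g :: complex poly)"
  have c: "?c \<noteq> 0" using f by (simp add: c_def)
  have M: "M \<in> carrier_mat d d"
    using companion_mat_carrier[of ?g] by (simp add: M_def d_def)
  have AM: "A = map_mat of_int M" by (simp add: A_def M_def map_mat_companion_mat)
  have A: "A \<in> carrier_mat d d" using M by (simp add: AM)
  have card: "card ?Z = n" using n by (rule card_roots_unity_eq)
  have "map_mat of_int (M ^\<^sub>m n - c ^ n \<cdot>\<^sub>m 1\<^sub>m d) = A ^\<^sub>m n - ?c ^ n \<cdot>\<^sub>m 1\<^sub>m d"
    unfolding AM of_int_hom.mat_hom_pow[OF M, symmetric]
    by (rule eq_matI) (use M in auto)
  then have "of_int ?D = det (A ^\<^sub>m n - ?c ^ n \<cdot>\<^sub>m 1\<^sub>m d)"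
    by (metis of_int_hom.hom_det)
  also have "\<dots> = (\<Prod>z\<in>?Z. det (A - (?c * z) \<cdot>\<^sub>m 1\<^sub>m d))"
    by (rule det_power_diff_scalar[OF A n c])
  also have "\<dots> = (\<Prod>z\<in>?Z. (- 1) ^ d * poly (of_int_poly ?g) (?c * z))"
  proof (intro prod.cong refl)
    fix z
    have "A - (?c * z) \<cdot>\<^sub>m 1\<^sub>m d = (- 1) \<cdot>\<^sub>m ((?c * z) \<cdot>\<^sub>m 1\<^sub>m d - A)"
      by (rule eq_matI) (use A in auto)
    moreover have "det ((?c * z) \<cdot>\<^sub>m 1\<^sub>m d - A) = poly (of_int_poly ?g) (?c * z)"
      using det_companion_mat[of "of_int_poly ?g :: complex poly" "?c * z"]
      by (simp add: A_def d_def coeff_monic_scaled)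
    ultimately show "det (A - (?c * z) \<cdot>\<^sub>m 1\<^sub>m d) = (- 1) ^ d * poly (of_int_poly ?g) (?c * z)"
      using A by simp
  qed
  also have "\<dots> ^ 2 * (?c ^ n) ^ 2 = (\<Prod>z\<in>?Z. (?c * poly (of_int_poly ?g) (?c * z)) ^ 2)"
    using card by (simp add: prod.distrib power_mult_distrib prod_power_distrib[symmetric]
      power_mult[symmetric] mult.commute[of _ 2] mult.left_commute[of _ 2])
  also have "\<dots> = (\<Prod>z\<in>?Z. (?c ^ d * poly (of_int_poly f) z) ^ 2)"
    unfolding c_def d_def poly_monic_scaled ..
  also have "\<dots> = (?c ^ n) ^ (2 * d) * (cyc_norm n f)\<^sup>2"
    using card by (simp add: cyc_norm_def prod.distrib power_mult_distrib prod_power_distrib[symmetric]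
      power_mult[symmetric] ac_simps)
  finally have "(of_int (?D\<^sup>2 * (c ^ n) ^ 2) :: complex) = (?c ^ n) ^ (2 * d) * (cyc_norm n f)\<^sup>2"
    by simp
  moreover have "(?c ^ n) ^ (2 * d) \<noteq> 0" using c by simp
  ultimately have "(cyc_norm n f)\<^sup>2 = 1 \<longleftrightarrow> (of_int (?D\<^sup>2 * (c ^ n) ^ 2) :: complex) = of_int ((c ^ n) ^ (2 * d))"
    by auto
  also have "\<dots> \<longleftrightarrow> ?D\<^sup>2 * (c ^ n) ^ 2 = (c ^ n) ^ (2 * d)"
    by (simp only: of_int_eq_iff)
  finally show ?thesis by simp
qed

text \<open>The inverse class of \<open>X^e\<close> is that of \<open>X^((n - 1) e)\<close>, as
  \<open>X^(n e)\<close> is congruent to 1.\<close>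

lemma cyc_norm_monom:
  assumes "n > 0"
  shows "(cyc_norm n (monom 1 e))\<^sup>2 = 1"
proof -
  have "(monom 1 n - 1 :: int poly) dvd (monom 1 n) ^ e - 1"
    by (metis dvd_triv_left power_diff_1_eq)
  then have "(monom 1 n - 1 :: int poly) dvd monom 1 e * monom 1 ((n - 1) * e) - 1"
    using assms by (simp add: monom_power mult_monom diff_mult_distrib)
  then show ?thesis using unit_iff_cyc_norm[OF assms, of "monom 1 e"] by blast
qed

section \<open>Generic units\<close>

lemma periodic_if_infinitely_many_units:
  fixes f :: "int poly"
  assumes inf: "infinite {n. n > 0 \<and> (cyc_norm n f)\<^sup>2 = 1}"
  obtains N r where "N > 0" "\<forall>k. r + N * k > 0 \<longrightarrow> (cyc_norm (r + N * k) f)\<^sup>2 = 1"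
proof -
  have "f \<noteq> 0"
  proof
    assume "f = 0"
    moreover have "cyc_norm n 0 = 0" if "n > 0" for n
      using that by (simp add: cyc_norm_def card_roots_unity_eq)
    ultimately show False using inf by (simp cong: conj_cong)
  qed
  \<comment> \<open>A power of \<open>X\<close> is a unit on every order. Splitting it off gives
    \<open>h(0) \<noteq> 0\<close>, which makes the companion matrix nonsingular.\<close>
  then obtain h where h: "f = [:- 0, 1:] ^ order 0 f * h" "\<not> [:- 0, 1:] dvd h"
    using order_decomp by blast
  define e where "e = order 0 f"
  have f: "f = monom 1 e * h"
    using h(1) by (simp add: e_def monom_altdef)
  have "poly h 0 \<noteq> 0"
    using h(2) poly_eq_0_iff_dvd[of h 0] by simp
  then have h0: "coeff h 0 \<noteq> 0" "h \<noteq> 0"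
    by (auto simp: poly_0_coeff_0)
  define M where "M = companion_mat (monic_scaled h)"
  have M: "M \<in> carrier_mat (degree h) (degree h)"
    using companion_mat_carrier[of "monic_scaled h"] by (simp add: M_def)
  let ?c = "lead_coeff h" and ?d = "degree h"
  let ?F = "\<lambda>n. (det (M ^\<^sub>m n - ?c ^ n \<cdot>\<^sub>m 1\<^sub>m ?d))\<^sup>2 * (?c ^ n) ^ 2 - (?c ^ n) ^ (2 * ?d)"
  have iff: "(cyc_norm n f)\<^sup>2 = 1 \<longleftrightarrow> ?F n = 0" if "n > 0" for n
    using that cyc_norm_eq_det[OF h0(2) that]
    by (simp add: f cyc_norm_mult power_mult_distrib cyc_norm_monom M_def)
  obtain N where N: "N > 0" "\<forall>r k. infinite {k. ?F (r + N * k) = 0} \<longrightarrow> ?F (r + N * k) = 0"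
  proof (rule det_power_periodic_zeros[OF M, of ?c 2 "2 * ?d"])
    show "det M \<noteq> 0" unfolding M_def using h0(1) by (rule det_companion_mat_monic_scaled)
    show "?c \<noteq> 0" using h0(2) by simp
  qed
  \<comment> \<open>If each of the \<open>N\<close> residue classes had finitely many zeros, there
    would be only finitely many unit orders.\<close>
  have "\<exists>r. infinite {k. ?F (r + N * k) = 0}"
  proof (rule ccontr)
    assume "\<nexists>r. infinite {k. ?F (r + N * k) = 0}"
    then have "finite (\<Union>r<N. (\<lambda>k. r + N * k) ` {k. ?F (r + N * k) = 0})" by auto
    moreover have "{n. n > 0 \<and> (cyc_norm n f)\<^sup>2 = 1} \<subseteq> (\<Union>r<N. (\<lambda>k. r + N * k) ` {k. ?F (r + N * k) = 0})"
    proof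
      fix n assume "n \<in> {n. n > 0 \<and> (cyc_norm n f)\<^sup>2 = 1}"
      then have "?F n = 0" using iff[of n] by simp
      then have "?F (n mod N + N * (n div N)) = 0"
        by (simp only: mod_mult_div_eq)
      moreover have "n mod N < N" "n = n mod N + N * (n div N)"
        using N(1) by simp_all
      ultimately show "n \<in> (\<Union>r<N. (\<lambda>k. r + N * k) ` {k. ?F (r + N * k) = 0})" by blast
    qed
    ultimately show False using inf finite_subset by blast
  qed
  then obtain r where "infinite {k. ?F (r + N * k) = 0}" ..
  then have "?F (r + N * k) = 0" for k by (rule N(2)[rule_format])
  then have "\<forall>k. r + N * k > 0 \<longrightarrow> (cyc_norm (r + N * k) f)\<^sup>2 = 1"
    by (intro allI impI) (simp only: iff)
  with N(1) show ?thesis by (rule that)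
qed

text \<open>Since \<open>X^n - 1\<close> divides \<open>X^m - 1\<close>, an inverse modulo the
  latter is also one modulo the former.\<close>

lemma unit_on_divisor:
  assumes "n > 0" "m > 0" "n dvd m" and f: "(cyc_norm m f)\<^sup>2 = 1"
  shows "(cyc_norm n f)\<^sup>2 = 1"
proof -
  obtain k where k: "m = n * k" using assms(3) by (auto elim: dvdE)
  have "(monom 1 n - 1 :: int poly) dvd (monom 1 n) ^ k - 1"
    by (metis dvd_triv_left power_diff_1_eq)
  then have dvd: "(monom 1 n - 1 :: int poly) dvd monom 1 m - 1"
    by (simp add: monom_power k mult.commute)
  obtain g where "monom 1 m - 1 dvd f * g - 1"
    using f unit_iff_cyc_norm[OF assms(2), of f] by blast
  with dvd have "monom 1 n - 1 dvd f * g - 1" by (rule dvd_trans)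
  then show ?thesis
    using unit_iff_cyc_norm[OF assms(1), of f] by blast
qed

lemma ex_multiple_in_progression:
  fixes n N r :: nat
  assumes "coprime n N" "n > 0" "N > 0"
  obtains k where "r + N * k > 0" "n dvd r + N * k"
proof -
  obtain x y where xy: "N * x = n * y + 1"
    using bezout_nat[of N n] assms by (auto simp: coprime_iff_gcd_eq_1 gcd.commute)
  \<comment> \<open>Here \<open>x\<close> inverts \<open>N\<close> modulo \<open>n\<close>, and
    \<open>n - 1\<close> stands for -1 in the naturals, so \<open>N * k\<close> is congruent to
    \<open>- r\<close>. The summand \<open>n\<close> makes \<open>k\<close> positive, even for
    \<open>r = 0\<close>.\<close>
  define k where "k = x * ((n - 1) * r) + n"
  have "r + N * k = (r + (n - 1) * r) + n * y * ((n - 1) * r) + N * n"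
    using xy by (simp add: k_def distrib_left distrib_right mult.assoc[symmetric])
  also have "r + (n - 1) * r = n * r"
    using assms(2) by (cases n) auto
  finally have "n dvd r + N * k" by simp
  moreover have "r + N * k > 0" using assms by (simp add: k_def)
  ultimately show ?thesis by (rule that[rotated])
qed

theorem corollary0p6:
  fixes f :: "int poly"
  shows "defines_generic_units f \<longleftrightarrow> infinite {n::nat. n > 0 \<and> defines_unit_on_order f n}"
proof
  assume "defines_generic_units f"
  then obtain D where D: "D > 0" "\<And>n. n > 0 \<Longrightarrow> coprime n D \<Longrightarrow> defines_unit_on_order f n"
    by (auto simp: defines_generic_units_def)
  \<comment> \<open>The numbers \<open>D * k + 1\<close> supply infinitely many orders coprime to
    \<open>D\<close>.\<close>
  have "coprime (D * k + 1) D" for k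
  proof (rule coprimeI)
    fix c assume "c dvd D * k + 1" "c dvd D"
    then show "c dvd 1" using dvd_add_right_iff[of c "D * k" 1] by simp
  qed
  then have "range (\<lambda>k. D * k + 1) \<subseteq> {n. n > 0 \<and> defines_unit_on_order f n}"
    using D(2) by (simp add: image_subset_iff)
  moreover have "infinite (range (\<lambda>k. D * k + 1))"
    using D(1) by (intro range_inj_infinite) (auto simp: inj_on_def)
  ultimately show "infinite {n. n > 0 \<and> defines_unit_on_order f n}"
    by (auto dest: finite_subset)
next
  have iff: "defines_unit_on_order f n \<longleftrightarrow> (cyc_norm n f)\<^sup>2 = 1" if "n > 0" for n
    using defines_unit_on_order_iff_quotient[OF that, of f] unit_iff_cyc_norm[OF that, of f] by simp
  assume "infinite {n. n > 0 \<and> defines_unit_on_order f n}"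
  then have "infinite {n. n > 0 \<and> (cyc_norm n f)\<^sup>2 = 1}"
    using iff by (simp cong: conj_cong)
  then obtain N r where N: "N > 0" "\<forall>k. r + N * k > 0 \<longrightarrow> (cyc_norm (r + N * k) f)\<^sup>2 = 1"
    by (rule periodic_if_infinitely_many_units)
  \<comment> \<open>The period \<open>N\<close> itself serves as \<open>D\<close>: an order coprime
    to \<open>N\<close> divides a positive member of the progression, and the unit property descends
    to divisors.\<close>
  have "defines_unit_on_order f n" if n: "n > 0" "coprime n N" for n
  proof -
    obtain k where k: "r + N * k > 0" "n dvd r + N * k"
      by (rule ex_multiple_in_progression[OF n(2,1) N(1)])
    show ?thesis
      using unit_on_divisor[OF n(1) k N(2)[rule_format, OF k(1)]] iff[OF n(1)] by blast
  qed
  with N(1) show "defines_generic_units f"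
    by (auto simp: defines_generic_units_def)
qed

end
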